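(* Let $n,r$ be positive integers and let $a=(a_1,\dots,a_r)$ with $a_1\ge\dots\ge a_r\ge0$ integers and $\sum_ka_k=n$. Let $w(a)$ be the number of distinct sequences obtained by permuting $(a_1,\dots,a_r)$. Then $$\sum_{s=1}^rN_{-\zeta^s}(a)=w(a)\,A_1(a)\qquad\text{and}\qquad\sum_{s=1}^rN_{\zeta^s}(a)=w(a)\,A_0(a).$$
   Context: $G(n,r)=\mathbb{Z}_r^n\rtimes S_n$, where $\mathbb{Z}_r=\mathbb{Z}/r\mathbb{Z}$ and $S_n$ permutes coordinates; $G(0,r)$ is trivial. $P(n,r)$ is the set of $r$-tuples $\lambda=(\lambda_1,\dots,\lambda_r)$ of partitions (possibly empty) with $\sum_k|\lambda_k|=n$. Fix a primitive $r$-th root of unity $\zeta$; also write $\zeta$ for the character $\zeta(x;w)=\zeta^{x_1+\dots+x_n}$ of $G(n,r)$ and $\mathrm{sgn}(x;w)$ for the sign of $w$. For a partition $\mu$ of $m$, let $\rho_\mu$ be the corresponding irreducible complex representation of $S_m$, $\chi_\mu$ its character, $f_\mu$ its dimension, and $\rho_\mu^k(x;w)=\zeta^{k(x_1+\dots+x_m)}\rho_\mu(w)$ its extension to $G(m,r)$. For $\lambda\in P(n,r)$ with $b_k=|\lambda_k|$, the irreducible representation of $G(n,r)$ indexed by $\lambda$ is $$\rho_\lambda=\mathrm{Ind}_{G(b_1,r)\times\dots\times G(b_r,r)}^{G(n,r)}\ \rho_{\lambda_1}^{0}\boxtimes\rho_{\lambda_2}^{1}\boxtimes\dots\boxtimes\rho_{\lambda_r}^{r-1}.$$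 $N_{\zeta^s}(a)$ (resp. $N_{-\zeta^s}(a)$) is the number of $\lambda\in P(n,r)$ such that $(|\lambda_1|,\dots,|\lambda_r|)$ is a rearrangement of $a$ and the character $\det\rho_\lambda$ equals $\zeta^s$ (resp. $\zeta^s\cdot\mathrm{sgn}$); for $n=1$, where $\mathrm{sgn}$ is trivial, $N_{-\zeta^s}(a)=0$. Put $g_\mu=\frac{f_\mu-\chi_\mu(s_1)}2$ with $s_1=(1\,2)$ for $|\mu|\ge2$ and $g_\mu=0$ for $|\mu|<2$; $\widehat f_{\lambda_k}=\prod_{j\ne k}f_{\lambda_j}$; multinomial coefficients with a negative lower entry are $0$. For $n\ge2$ and $\lambda$ with $|\lambda_k|=b_k$, $$y_\lambda=f_{\lambda_1}\cdots f_{\lambda_r}\frac{(n-2)!}{b_1!\cdots b_r!}\sum_{1\le i<j\le r}b_ib_j+\sum_{k=1}^r g_{\lambda_k}\widehat f_{\lambda_k}\binom{n-2}{b_1,\dots,b_k-2,\dots,b_r},$$ and $y_\lambda=0$ for $n=1$. $A_0(a)$ (resp. $A_1(a)$) is the number of $\lambda\in P(n,r)$ with $|\lambda_k|=a_k$ for all $k$ (in this order) and $y_\lambda$ even (resp. odd). *)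

theory Defs
  imports
    "HOL-Algebra.Sym_Groups"
    "HOL-Algebra.Product_Groups"
    "HOL-Combinatorics.Combinatorics"
    "HOL-Library.Function_Algebras"
    "Jordan_Normal_Form.Determinant"
begin

text \<open>
  Sequences are 0-indexed lists: the k-th entry (k = 1,...,r) of an r-tuple is \<open>L ! (k - 1)\<close>.
  Permutations act on \<open>{1..n}\<close>, as in \<^const>\<open>sym_group\<close>.
\<close>

subsection \<open>The groups G(n,r)\<close>

text \<open>
  \<open>S\<^sub>n\<close> acts on \<open>\<int>\<^sub>r\<^sup>n\<close> on the left by \<open>(w \<cdot> x)\<^sub>i = x\<^sub>j\<close> with \<open>j = w\<^sup>-\<^sup>1(i)\<close>;
  hence the product \<open>(x;w)(y;v) = (x + w \<cdot> y; w v)\<close>.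
\<close>

definition Zpow :: "nat \<Rightarrow> nat \<Rightarrow> (nat \<Rightarrow> int) monoid" where
  "Zpow n r = product_group {1..n} (\<lambda>_. integer_mod_group r)"

definition permute_coords :: "nat \<Rightarrow> (nat \<Rightarrow> nat) \<Rightarrow> (nat \<Rightarrow> int) \<Rightarrow> nat \<Rightarrow> int" where
  "permute_coords n w x = (\<lambda>i\<in>{1..n}. x ((inv\<^bsub>sym_group n\<^esub> w) i))"

type_synonym gelem = "(nat \<Rightarrow> int) \<times> (nat \<Rightarrow> nat)"

definition Gnr :: "nat \<Rightarrow> nat \<Rightarrow> gelem monoid" where
  "Gnr n r = \<lparr> carrier = carrier (Zpow n r) \<times> carrier (sym_group n),
     mult = (\<lambda>(x, w) (y, v).
       (x \<otimes>\<^bsub>Zpow n r\<^esub> permute_coords n w y, w \<otimes>\<^bsub>sym_group n\<^esub> v)),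
     one = (\<one>\<^bsub>Zpow n r\<^esub>, \<one>\<^bsub>sym_group n\<^esub>) \<rparr>"

definition primitive_unity_root :: "nat \<Rightarrow> complex \<Rightarrow> bool" where
  "primitive_unity_root r \<zeta> \<longleftrightarrow> \<zeta> ^ r = 1 \<and> (\<forall>k. 0 < k \<and> k < r \<longrightarrow> \<zeta> ^ k \<noteq> 1)"

definition zeta_char :: "nat \<Rightarrow> complex \<Rightarrow> gelem \<Rightarrow> complex" where
  "zeta_char n \<zeta> = (\<lambda>(x, w). \<zeta> powi (\<Sum>i\<in>{1..n}. x i))"

definition sgn_char :: "gelem \<Rightarrow> complex" where
  "sgn_char = (\<lambda>(x, w). of_int (sign w))"

subsection \<open>Partitions\<close>

definition is_partition :: "nat list \<Rightarrow> bool" where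
  "is_partition \<mu> \<longleftrightarrow> sorted_wrt (\<ge>) \<mu> \<and> 0 \<notin> set \<mu>"

abbreviation (input) psize :: "nat list \<Rightarrow> nat" where
  "psize \<mu> \<equiv> sum_list \<mu>"

definition Pnr :: "nat \<Rightarrow> nat \<Rightarrow> nat list list set" where
  "Pnr n r = {L. length L = r \<and> (\<forall>\<mu>\<in>set L. is_partition \<mu>) \<and> sum_list (map psize L) = n}"

subsection \<open>Representations afforded by submodules of the group algebra\<close>

text \<open>
  Elements of the group algebra are complex functions vanishing off the carrier; the
  functions \<open>'a \<Rightarrow> complex\<close> form the ambient complex vector space.
\<close>

definition fscale :: "complex \<Rightarrow> ('a \<Rightarrow> complex) \<Rightarrow> 'a \<Rightarrow> complex" where
  "fscale c f = (\<lambda>x. c * f x)"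

global_interpretation fun_space: vector_space "fscale :: complex \<Rightarrow> ('a \<Rightarrow> complex) \<Rightarrow> _"
  by unfold_locales (auto simp: fscale_def plus_fun_def algebra_simps)

definition convolution ::
    "('a, 'm) monoid_scheme \<Rightarrow> ('a \<Rightarrow> complex) \<Rightarrow> ('a \<Rightarrow> complex) \<Rightarrow> 'a \<Rightarrow> complex" where
  "convolution G f h = (\<lambda>x. if x \<in> carrier G
     then (\<Sum>y\<in>carrier G. f y * h (inv\<^bsub>G\<^esub> y \<otimes>\<^bsub>G\<^esub> x)) else 0)"

definition left_translate ::
    "('a, 'm) monoid_scheme \<Rightarrow> 'a \<Rightarrow> ('a \<Rightarrow> complex) \<Rightarrow> 'a \<Rightarrow> complex" where
  "left_translate G g f = (\<lambda>x. if x \<in> carrier G then f (inv\<^bsub>G\<^esub> g \<otimes>\<^bsub>G\<^esub> x) else 0)"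

definition chosen_basis :: "('a \<Rightarrow> complex) set \<Rightarrow> ('a \<Rightarrow> complex) list" where
  "chosen_basis V = (SOME bs. distinct bs \<and> fun_space.independent (set bs) \<and>
     fun_space.span (set bs) = V)"

definition submodule_mat ::
    "('a, 'm) monoid_scheme \<Rightarrow> ('a \<Rightarrow> complex) set \<Rightarrow> 'a \<Rightarrow> complex mat" where
  "submodule_mat G V g = (let bs = chosen_basis V in
     mat (length bs) (length bs)
       (\<lambda>(i, j). fun_space.representation (set bs) (left_translate G g (bs ! j)) (bs ! i)))"

definition mat_trace :: "complex mat \<Rightarrow> complex" where
  "mat_trace A = (\<Sum>i<dim_row A. A $$ (i, i))"

subsection \<open>The irreducible representations of the symmetric group\<close>

text \<open>
  \<open>\<rho>\<^sub>\<mu>\<close> is afforded by the left ideal \<open>\<complex>[S\<^sub>m] a\<^sub>T b\<^sub>T\<close> generated by the Young symmetrizer of the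
  tableau \<open>T\<close> of shape \<open>\<mu>\<close> filled with 1,...,m row by row. In this convention \<open>[m]\<close> gives
  the trivial representation. \<open>row_of\<close> is 0-based and \<open>col_of\<close> 1-based.
\<close>

definition row_of :: "nat list \<Rightarrow> nat \<Rightarrow> nat" where
  "row_of \<mu> i = (LEAST k. i \<le> sum_list (take (Suc k) \<mu>))"

definition col_of :: "nat list \<Rightarrow> nat \<Rightarrow> nat" where
  "col_of \<mu> i = i - sum_list (take (row_of \<mu> i) \<mu>)"

definition row_sum :: "nat list \<Rightarrow> (nat \<Rightarrow> nat) \<Rightarrow> complex" where
  "row_sum \<mu> p = (if p \<in> carrier (sym_group (psize \<mu>)) \<and>
       (\<forall>i\<in>{1..psize \<mu>}. row_of \<mu> (p i) = row_of \<mu> i) then 1 else 0)"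

definition col_signed_sum :: "nat list \<Rightarrow> (nat \<Rightarrow> nat) \<Rightarrow> complex" where
  "col_signed_sum \<mu> q = (if q \<in> carrier (sym_group (psize \<mu>)) \<and>
       (\<forall>i\<in>{1..psize \<mu>}. col_of \<mu> (q i) = col_of \<mu> i) then of_int (sign q) else 0)"

definition young_symmetrizer :: "nat list \<Rightarrow> (nat \<Rightarrow> nat) \<Rightarrow> complex" where
  "young_symmetrizer \<mu> =
     convolution (sym_group (psize \<mu>)) (row_sum \<mu>) (col_signed_sum \<mu>)"

definition specht :: "nat list \<Rightarrow> ((nat \<Rightarrow> nat) \<Rightarrow> complex) set" where
  "specht \<mu> = range (\<lambda>f. convolution (sym_group (psize \<mu>)) f (young_symmetrizer \<mu>))"

definition rho_S :: "nat list \<Rightarrow> (nat \<Rightarrow> nat) \<Rightarrow> complex mat" where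
  "rho_S \<mu> = submodule_mat (sym_group (psize \<mu>)) (specht \<mu>)"

definition chi_S :: "nat list \<Rightarrow> (nat \<Rightarrow> nat) \<Rightarrow> complex" where
  "chi_S \<mu> w = mat_trace (rho_S \<mu> w)"

definition f_dim :: "nat list \<Rightarrow> nat" where
  "f_dim \<mu> = fun_space.dim (specht \<mu>)"

definition rho_ext :: "complex \<Rightarrow> nat \<Rightarrow> nat list \<Rightarrow> gelem \<Rightarrow> complex mat" where
  "rho_ext \<zeta> k \<mu> g = (zeta_char (psize \<mu>) \<zeta> g) ^ k \<cdot>\<^sub>m rho_S \<mu> (snd g)"

subsection \<open>External tensor products and induction\<close>

definition kron :: "complex mat \<Rightarrow> complex mat \<Rightarrow> complex mat" where
  "kron A B = mat (dim_row A * dim_row B) (dim_col A * dim_col B)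
     (\<lambda>(i, j). A $$ (i div dim_row B, j div dim_col B) * B $$ (i mod dim_row B, j mod dim_col B))"

text \<open>
  With \<open>b\<^sub>k = |\<lambda>\<^sub>k|\<close>, the product \<open>G(b\<^sub>1,r) \<times> \<dots> \<times> G(b\<^sub>r,r)\<close> is identified with the subgroup of
  those \<open>(x;w) \<in> G(n,r)\<close> for which \<open>w\<close> preserves each of the consecutive blocks of sizes
  \<open>b\<^sub>1,\<dots>,b\<^sub>r\<close> in \<open>{1..n}\<close>; \<open>block_part\<close> is the projection to the k-th factor,
  relabelling the block as \<open>{1..b\<^sub>k}\<close>.
\<close>

definition block_off :: "nat list \<Rightarrow> nat \<Rightarrow> nat" where
  "block_off b k = sum_list (take k b)"

definition block_subgroup :: "nat list \<Rightarrow> nat \<Rightarrow> gelem set" where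
  "block_subgroup b r = {(x, w) \<in> carrier (Gnr (sum_list b) r). \<forall>k<length b.
     w ` {block_off b k + 1 .. block_off b k + b ! k} =
         {block_off b k + 1 .. block_off b k + b ! k}}"

definition block_part :: "nat list \<Rightarrow> nat \<Rightarrow> gelem \<Rightarrow> gelem" where
  "block_part b k = (\<lambda>(x, w).
     (\<lambda>i\<in>{1..b ! k}. x (block_off b k + i),
      \<lambda>i. if i \<in> {1..b ! k} then w (block_off b k + i) - block_off b k else i))"

text \<open>With 0-based \<open>k\<close>, the component \<open>L ! k\<close> is twisted by the k-th power of the character \<open>\<zeta>\<close>.\<close>

definition block_tensor :: "complex \<Rightarrow> nat list list \<Rightarrow> gelem \<Rightarrow> complex mat" where
  "block_tensor \<zeta> L g = foldr kron
     (map (\<lambda>k. rho_ext \<zeta> k (L ! k) (block_part (map psize L) k g)) [0..<length L]) (1\<^sub>m 1)"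

text \<open>
  The matrix of the representation induced from a representation \<open>\<sigma>\<close> of \<open>H\<close>, relative to left coset
  representatives \<open>t\<^sub>0, t\<^sub>1, \<dots>\<close>: its (i,j) block is \<open>\<sigma>(t\<^sub>i\<^sup>-\<^sup>1 g t\<^sub>j)\<close> if \<open>t\<^sub>i\<^sup>-\<^sup>1 g t\<^sub>j \<in> H\<close>, and 0 otherwise.
\<close>

definition chosen_transversal :: "('a, 'm) monoid_scheme \<Rightarrow> 'a set \<Rightarrow> 'a list" where
  "chosen_transversal G H = (SOME ts. set ts \<subseteq> carrier G \<and>
     (\<forall>g\<in>carrier G. \<exists>!i. i < length ts \<and> g \<in> (ts ! i) <#\<^bsub>G\<^esub> H))"

definition induced_mat ::
    "('a, 'm) monoid_scheme \<Rightarrow> 'a set \<Rightarrow> ('a \<Rightarrow> complex mat) \<Rightarrow> 'a \<Rightarrow> complex mat" where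
  "induced_mat G H \<sigma> g = (let ts = chosen_transversal G H; d = dim_row (\<sigma> \<one>\<^bsub>G\<^esub>) in
     mat (length ts * d) (length ts * d)
       (\<lambda>(i, j). let h = inv\<^bsub>G\<^esub> (ts ! (i div d)) \<otimes>\<^bsub>G\<^esub> g \<otimes>\<^bsub>G\<^esub> ts ! (j div d) in
          if h \<in> H then \<sigma> h $$ (i mod d, j mod d) else 0))"

definition rho :: "complex \<Rightarrow> nat list list \<Rightarrow> gelem \<Rightarrow> complex mat" where
  "rho \<zeta> L = induced_mat (Gnr (sum_list (map psize L)) (length L))
     (block_subgroup (map psize L) (length L)) (block_tensor \<zeta> L)"

subsection \<open>Counting functions\<close>

text \<open>In the following, \<open>n\<close> and \<open>r\<close> are the sum and the length of \<open>a\<close>.\<close>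

definition N_plus :: "complex \<Rightarrow> nat list \<Rightarrow> nat \<Rightarrow> nat" where
  "N_plus \<zeta> a s = (let n = sum_list a; r = length a in
     card {L \<in> Pnr n r. mset (map psize L) = mset a \<and>
       (\<forall>g\<in>carrier (Gnr n r). det (rho \<zeta> L g) = zeta_char n \<zeta> g ^ s)})"

definition N_minus :: "complex \<Rightarrow> nat list \<Rightarrow> nat \<Rightarrow> nat" where
  "N_minus \<zeta> a s = (let n = sum_list a; r = length a in
     if n = 1 then 0 else
     card {L \<in> Pnr n r. mset (map psize L) = mset a \<and>
       (\<forall>g\<in>carrier (Gnr n r). det (rho \<zeta> L g) = zeta_char n \<zeta> g ^ s * sgn_char g)})"

definition w_count :: "nat list \<Rightarrow> nat" where
  "w_count a = card (permutations_of_multiset (mset a))"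

definition g_mult :: "nat list \<Rightarrow> complex" where
  "g_mult \<mu> = (if psize \<mu> \<ge> 2
     then (of_nat (f_dim \<mu>) - chi_S \<mu> (Transposition.transpose 1 2)) / 2 else 0)"

definition f_hat :: "nat list list \<Rightarrow> nat \<Rightarrow> nat" where
  "f_hat L k = (\<Prod>j\<in>{..<length L} - {k}. f_dim (L ! j))"

definition multinomial :: "nat \<Rightarrow> int list \<Rightarrow> complex" where
  "multinomial N cs = (if \<exists>c\<in>set cs. c < 0 then 0
     else fact N / (\<Prod>i<length cs. fact (nat (cs ! i))))"

definition y_val :: "nat list list \<Rightarrow> complex" where
  "y_val L = (let b = map psize L; n = sum_list b; r = length L in
     if n \<le> 1 then 0 else
       of_nat (\<Prod>k<r. f_dim (L ! k)) * (fact (n - 2) / (\<Prod>k<r. fact (b ! k))) *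
         of_nat (\<Sum>j<r. \<Sum>i<j. b ! i * b ! j) +
       (\<Sum>k<r. g_mult (L ! k) * of_nat (f_hat L k) *
         multinomial (n - 2) ((map int b)[k := int (b ! k) - 2])))"

definition A0 :: "nat list \<Rightarrow> nat" where
  "A0 a = card {L \<in> Pnr (sum_list a) (length a). map psize L = a \<and>
     (\<exists>m::int. y_val L = of_int m \<and> even m)}"

definition A1 :: "nat list \<Rightarrow> nat" where
  "A1 a = card {L \<in> Pnr (sum_list a) (length a). map psize L = a \<and>
     (\<exists>m::int. y_val L = of_int m \<and> odd m)}"

end

theory Submission
  imports Defs "Jordan_Normal_Form.Schur_Decomposition"
begin

text \<open>
  The determinant of \<open>\<rho>\<^sub>\<lambda>\<close> is a linear character of \<open>G(n,r)\<close>. Since transpositions, and likewise the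
  unit vectors of \<open>\<int>\<^sub>r\<^sup>n\<close>, are conjugate, such a character is \<open>\<zeta>\<^sup>s\<close> or \<open>\<zeta>\<^sup>s \<cdot> sgn\<close> for a unique \<open>s\<close> modulo
  \<open>r\<close>, and the two cases are told apart by its value \<open>(-1)\<^sup>m\<close> at the transposition \<open>(1 2)\<close>, where \<open>m\<close> is
  the multiplicity of the eigenvalue \<open>-1\<close>, that is, half the difference between the dimension
  and the trace. Averaging the trace formula for induced representations over all conjugates
  of \<open>(1 2)\<close> shows \<open>m = y\<^sub>\<lambda>\<close>. Finally \<open>y\<^sub>\<lambda>\<close> is invariant under permuting the components of \<open>\<lambda>\<close>.
\<close>

subsection \<open>Traces and Kronecker products\<close>

text \<open>The formula for \<open>y_val\<close> is half of dimension minus trace, sorted by ordered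
  pairs of distinct points of {1..n}. Conjugating (1 2) gives the transposition of such a pair. If
  the two points lie in different blocks, the conjugate leaves the block subgroup and adds nothing
  to the trace; such pairs produce the terms b_i b_j. If both lie in block k, dimension minus trace
  picks up f_k - \<chi>_k at (1 2), that is 2 g_k, times \<open>f_hat\<close>; such pairs produce
  the multinomial terms.

  \<open>y_val\<close> is a complex number written with quotients, while \<open>A0\<close> and
  \<open>A1\<close> count only those \<lambda> for which it is an integer. Integrality is not
  visible in the formula and comes from the identification with a multiplicity. The comparison is
  made after multiplying by 2 and by the product of the b_k!, and Frobenius' formula is multiplied
  by the order of the subgroup, so that it becomes a sum over the whole group, independent of the
  transversal picked by \<open>SOME\<close>.

  For n = 1 the transposition (1 2) is not in the group; the sign is then trivial, y is 0 and
  \<open>N_minus\<close> is 0 by convention.\<close>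

lemma mat_trace_one [simp]: "mat_trace (1\<^sub>m d) = of_nat d"
  by (simp add: mat_trace_def)

lemma mat_trace_smult: "A \<in> carrier_mat d d \<Longrightarrow> mat_trace (c \<cdot>\<^sub>m A) = c * mat_trace A"
  by (simp add: mat_trace_def sum_distrib_left)

lemma smult_mat_mult_smult_mat:
  fixes A B :: "'a :: comm_semiring_0 mat"
  assumes "A \<in> carrier_mat m m" "B \<in> carrier_mat m m"
  shows "(c \<cdot>\<^sub>m A) * (c' \<cdot>\<^sub>m B) = (c * c') \<cdot>\<^sub>m (A * B)"
  by (rule eq_matI) (use assms in \<open>auto simp: scalar_prod_def sum_distrib_left ac_simps\<close>)

lemma mat_trace_mult_commute:
  assumes "A \<in> carrier_mat d d" "B \<in> carrier_mat d d"
  shows "mat_trace (A * B) = mat_trace (B * A)"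
proof -
  have "mat_trace (A * B) = (\<Sum>i<d. \<Sum>k<d. A $$ (i, k) * B $$ (k, i))"
    using assms by (auto simp: mat_trace_def scalar_prod_def atLeast0LessThan intro!: sum.cong)
  also have "\<dots> = (\<Sum>k<d. \<Sum>i<d. B $$ (k, i) * A $$ (i, k))"
    by (subst sum.swap) (simp add: mult.commute)
  also have "\<dots> = mat_trace (B * A)"
    using assms by (auto simp: mat_trace_def scalar_prod_def atLeast0LessThan intro!: sum.cong)
  finally show ?thesis .
qed

lemma mat_trace_similar:
  assumes "similar_mat A B"
  shows "mat_trace A = mat_trace B"
proof -
  obtain d P Q where *: "A \<in> carrier_mat d d" "B \<in> carrier_mat d d" "P \<in> carrier_mat d d"
      "Q \<in> carrier_mat d d" "Q * P = 1\<^sub>m d" "A = P * B * Q"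
    using similar_matD[OF assms] by auto
  have "mat_trace A = mat_trace (Q * (P * B))"
    unfolding *(6) by (rule mat_trace_mult_commute[of _ d]) (use *(2-4) in auto)
  also have "Q * (P * B) = B"
    using assoc_mult_mat[OF *(4,3,2)] *(2,5) by simp
  finally show ?thesis .
qed

lemma upper_triangular_mult_diag:
  fixes B :: "complex mat"
  assumes "B \<in> carrier_mat d d" "upper_triangular B" "i < d"
  shows "(B * B) $$ (i, i) = (B $$ (i, i))\<^sup>2"
proof -
  have "(B * B) $$ (i, i) = (\<Sum>k<d. B $$ (i, k) * B $$ (k, i))"
    using assms by (simp add: scalar_prod_def atLeast0LessThan)
  also have "\<dots> = (\<Sum>k<d. if k = i then (B $$ (i, i))\<^sup>2 else 0)"
  proof (rule sum.cong[OF refl])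
    fix k assume "k \<in> {..<d}"
    then show "B $$ (i, k) * B $$ (k, i) = (if k = i then (B $$ (i, i))\<^sup>2 else 0)"
      using assms upper_triangularD[of B]
      by (cases k i rule: linorder_cases) (auto simp: power2_eq_square)
  qed
  also have "\<dots> = (B $$ (i, i))\<^sup>2"
    using assms by simp
  finally show ?thesis .
qed

text \<open>Schur triangulation instead of diagonalisation: an upper triangular matrix with square 1
  has diagonal entries 1 and -1, and determinant and trace depend on the diagonal only.
  \<open>m\<close> counts the entries -1.\<close>

lemma involution_det_trace:
  fixes A :: "complex mat"
  assumes A: "A \<in> carrier_mat d d" and sq: "A * A = 1\<^sub>m d"
  obtains m :: nat where "det A = (-1) ^ m" "mat_trace A = of_nat d - 2 * of_nat m"
proof -
  obtain as where as: "char_poly A = (\<Prod>a\<leftarrow>as. [:- a, 1:])"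
    using char_poly_factorized[OF A] by blast
  obtain B where B: "B \<in> carrier_mat d d" "upper_triangular B" "similar_mat A B"
    using schur_decomposition_exists[OF A as] by blast
  then obtain P Q where PQ: "similar_mat_wit A B P Q"
    unfolding similar_mat_def by blast
  have BB: "B * B = 1\<^sub>m d"
  proof -
    have "similar_mat_wit B A Q P"
      using PQ by (rule similar_mat_wit_sym)
    then have *: "Q * P = 1\<^sub>m d" "P * Q = 1\<^sub>m d"
      "Q \<in> carrier_mat d d" "P \<in> carrier_mat d d"
      using B(1) unfolding similar_mat_wit_def by (auto simp: Let_def)
    have "B * B = B ^\<^sub>m 2"
      using B(1) by (simp add: numeral_2_eq_2)
    also have "\<dots> = Q * (A ^\<^sub>m 2) * P"
      using \<open>similar_mat_wit B A Q P\<close> by (rule similar_mat_wit_pow_id)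
    also have "A ^\<^sub>m 2 = 1\<^sub>m d"
      using A sq by (simp add: numeral_2_eq_2)
    also have "Q * 1\<^sub>m d * P = 1\<^sub>m d"
      using * by simp
    finally show ?thesis .
  qed
  define M where "M = {i. i < d \<and> B $$ (i, i) = -1}"
  have fin: "finite M" "M \<subseteq> {..<d}" by (auto simp: M_def)
  have diag: "B $$ (i, i) = (if i \<in> M then -1 else 1)" if "i < d" for i
  proof -
    have "(B $$ (i, i))\<^sup>2 = 1"
      using upper_triangular_mult_diag[OF B(1,2) that] BB that by simp
    then show ?thesis
      using that by (auto simp: M_def power2_eq_1_iff)
  qed
  have "det A = det B"
    using det_similar[OF B(3)] .
  also have "\<dots> = (\<Prod>i<d. B $$ (i, i))"
    using B(1) det_upper_triangular[OF B(2,1)]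
    by (simp add: diag_mat_def prod.distinct_set_conv_list atLeast0LessThan[symmetric] flip: set_upt)
  also have "\<dots> = (\<Prod>i<d. if i \<in> M then -1 else 1)"
    using diag by (intro prod.cong) auto
  also have "\<dots> = (\<Prod>i\<in>M. -1)"
    using fin by (subst prod.inter_restrict[symmetric]) (auto simp: Int_absorb1)
  finally have 1: "det A = (-1) ^ card M"
    by simp
  have "mat_trace A = (\<Sum>i<d. B $$ (i, i))"
    using mat_trace_similar[OF B(3)] B by (simp add: mat_trace_def)
  also have "\<dots> = (\<Sum>i<d. 1 - (if i \<in> M then 2 else 0))"
    using diag by (intro sum.cong) auto
  also have "\<dots> = of_nat d - (\<Sum>i\<in>M. 2)"
    using fin by (simp add: sum_subtractf sum.inter_restrict[symmetric] Int_absorb1)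
  finally have "mat_trace A = of_nat d - 2 * of_nat (card M)"
    by simp
  with 1 that show ?thesis by blast
qed

section \<open>Kronecker products and their iteration\<close>

lemma dim_kron [simp]:
  "dim_row (kron A B) = dim_row A * dim_row B" "dim_col (kron A B) = dim_col A * dim_col B"
  by (simp_all add: kron_def)

lemma kron_carrier:
  "A \<in> carrier_mat m m \<Longrightarrow> B \<in> carrier_mat n n \<Longrightarrow> kron A B \<in> carrier_mat (m * n) (m * n)"
  by (intro carrier_matI) auto

lemma nat_index_less: "i < m \<Longrightarrow> j < n \<Longrightarrow> i * n + j < m * (n::nat)"
  using mult_le_mono1[of "Suc i" m n] by simp

text \<open>Kronecker products and induced matrices both encode a pair of indices as quotient and
  remainder; this turns their matrix products and traces into double sums.\<close>

lemma sum_divmod: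
  fixes f :: "nat \<Rightarrow> nat \<Rightarrow> 'a :: comm_monoid_add"
  shows "(\<Sum>i<m * n. f (i div n) (i mod n)) = (\<Sum>i<m. \<Sum>j<n. f i j)"
proof (cases "n = 0")
  case False
  have "(\<Sum>i<m * n. f (i div n) (i mod n)) = (\<Sum>(i, j)\<in>{..<m} \<times> {..<n}. f i j)"
    using False
    by (intro sum.reindex_bij_witness[of _ "\<lambda>(i, j). i * n + j" "\<lambda>i. (i div n, i mod n)"])
      (auto simp: less_mult_imp_div_less intro: nat_index_less)
  then show ?thesis
    by (simp add: sum.cartesian_product)
qed simp

text \<open>The mixed-product rule, which makes an external tensor product of homomorphisms a
  homomorphism.\<close>

lemma kron_mult:
  assumes "A \<in> carrier_mat m m" "A' \<in> carrier_mat m m" "B \<in> carrier_mat n n" "B' \<in> carrier_mat n n"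
  shows "kron A B * kron A' B' = kron (A * A') (B * B')"
proof (rule eq_matI)
  fix i j assume "i < dim_row (kron (A * A') (B * B'))" "j < dim_col (kron (A * A') (B * B'))"
  then have ij: "i < m * n" "j < m * n" using assms by auto
  then have n: "n > 0" by (cases n) auto
  have ij': "i div n < m" "j div n < m" "i mod n < n" "j mod n < n"
    using ij n by (auto simp: less_mult_imp_div_less)
  have "(kron A B * kron A' B') $$ (i, j) =
      (\<Sum>k<m * n. (A $$ (i div n, k div n) * B $$ (i mod n, k mod n)) *
                 (A' $$ (k div n, j div n) * B' $$ (k mod n, j mod n)))"
    using assms ij by (auto simp: kron_def scalar_prod_def atLeast0LessThan intro!: sum.cong)
  also have "\<dots> = (\<Sum>k<m. \<Sum>l<n. (A $$ (i div n, k) * B $$ (i mod n, l)) *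
                 (A' $$ (k, j div n) * B' $$ (l, j mod n)))"
    by (rule sum_divmod)
  also have "\<dots> = (\<Sum>k<m. A $$ (i div n, k) * A' $$ (k, j div n)) *
                 (\<Sum>l<n. B $$ (i mod n, l) * B' $$ (l, j mod n))"
    by (simp add: sum_product algebra_simps)
  also have "\<dots> = kron (A * A') (B * B') $$ (i, j)"
    using assms ij ij' by (simp add: kron_def scalar_prod_def atLeast0LessThan)
  finally show "(kron A B * kron A' B') $$ (i, j) = kron (A * A') (B * B') $$ (i, j)" .
qed (use assms in auto)

lemma kron_one: "kron (1\<^sub>m m) (1\<^sub>m n) = 1\<^sub>m (m * n)"
proof (rule eq_matI)
  fix i j assume "i < dim_row (1\<^sub>m (m * n))" "j < dim_col (1\<^sub>m (m * n))"
  then have ij: "i < m * n" "j < m * n" by auto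
  then have n: "n > 0" by (cases n) auto
  have "i = j" if "i div n = j div n" "i mod n = j mod n"
    using that by (metis div_mult_mod_eq)
  then show "kron (1\<^sub>m m) (1\<^sub>m n) $$ (i, j) = 1\<^sub>m (m * n) $$ (i, j)"
    using ij n by (auto simp: kron_def less_mult_imp_div_less)
qed auto

lemma mat_trace_kron:
  assumes "A \<in> carrier_mat m m" "B \<in> carrier_mat n n"
  shows "mat_trace (kron A B) = mat_trace A * mat_trace B"
proof -
  have "mat_trace (kron A B) = (\<Sum>i<m * n. A $$ (i div n, i div n) * B $$ (i mod n, i mod n))"
    using assms by (auto simp: mat_trace_def kron_def intro!: sum.cong)
  also have "\<dots> = mat_trace A * mat_trace B"
    using assms sum_divmod[of "\<lambda>i j. A $$ (i, i) * B $$ (j, j)" n m]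
    by (simp add: mat_trace_def sum_product)
  finally show ?thesis .
qed

lemma foldr_kron_carrier:
  assumes "\<And>k. k \<in> set ks \<Longrightarrow> A k \<in> carrier_mat (d k) (d k)"
  shows "foldr kron (map A ks) (1\<^sub>m 1) \<in> carrier_mat (prod_list (map d ks)) (prod_list (map d ks))"
  using assms
proof (induction ks)
  case (Cons k ks)
  then show ?case
    using kron_carrier[of "A k" "d k" _ "prod_list (map d ks)"] by simp
qed simp

lemma foldr_kron_mult:
  assumes "\<And>k. k \<in> set ks \<Longrightarrow> A k \<in> carrier_mat (d k) (d k)"
    and "\<And>k. k \<in> set ks \<Longrightarrow> B k \<in> carrier_mat (d k) (d k)"
  shows "foldr kron (map A ks) (1\<^sub>m 1) * foldr kron (map B ks) (1\<^sub>m 1) =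
    foldr kron (map (\<lambda>k. A k * B k) ks) (1\<^sub>m 1)"
  using assms
proof (induction ks)
  case (Cons k ks)
  have c: "foldr kron (map A ks) (1\<^sub>m 1) \<in> carrier_mat (prod_list (map d ks)) (prod_list (map d ks))"
    "foldr kron (map B ks) (1\<^sub>m 1) \<in> carrier_mat (prod_list (map d ks)) (prod_list (map d ks))"
    using Cons.prems by (intro foldr_kron_carrier; simp)+
  have "A k \<in> carrier_mat (d k) (d k)" "B k \<in> carrier_mat (d k) (d k)"
    using Cons.prems by auto
  from kron_mult[OF this c] show ?case
    using Cons by simp
qed simp

lemma mat_trace_foldr_kron:
  assumes "\<And>k. k \<in> set ks \<Longrightarrow> A k \<in> carrier_mat (d k) (d k)"
  shows "mat_trace (foldr kron (map A ks) (1\<^sub>m 1)) = prod_list (map (\<lambda>k. mat_trace (A k)) ks)"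
  using assms
proof (induction ks)
  case (Cons k ks)
  have c: "foldr kron (map A ks) (1\<^sub>m 1) \<in> carrier_mat (prod_list (map d ks)) (prod_list (map d ks))"
    using Cons.prems by (intro foldr_kron_carrier) simp
  have "A k \<in> carrier_mat (d k) (d k)"
    using Cons.prems by auto
  from mat_trace_kron[OF this c] show ?case
    using Cons by simp
qed simp

lemma foldr_kron_one:
  "foldr kron (map (\<lambda>k. 1\<^sub>m (d k)) ks) (1\<^sub>m 1) = 1\<^sub>m (prod_list (map d ks))"
  by (induction ks) (simp_all add: kron_one)

subsection \<open>Representations on submodules of the group algebra\<close>

lemma convolution_plus: "convolution G (f + f') h = convolution G f h + convolution G f' h"
  by (auto simp: convolution_def fun_eq_iff distrib_right sum.distrib)

lemma convolution_fscale: "convolution G (fscale c f) h = fscale c (convolution G f h)"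
  by (auto simp: convolution_def fun_eq_iff fscale_def sum_distrib_left mult.assoc)

lemma linear_left_translate: "Vector_Spaces.linear fscale fscale (left_translate G g)"
  by unfold_locales (auto simp: left_translate_def fscale_def fun_eq_iff algebra_simps)

lemma (in group) left_translate_mult:
  assumes "g \<in> carrier G" "h \<in> carrier G"
  shows "left_translate G (g \<otimes> h) f = left_translate G g (left_translate G h f)"
  using assms by (auto simp: left_translate_def fun_eq_iff inv_mult_group m_assoc)

lemma (in group) left_translate_one:
  assumes "\<And>x. x \<notin> carrier G \<Longrightarrow> f x = 0"
  shows "left_translate G \<one> f = f"
  using assms by (auto simp: left_translate_def fun_eq_iff)

text \<open>Left translation commutes with multiplication from the right, by the substitution of g y
  for y. Hence a left ideal generated by one element, such as \<open>specht\<close>, is stable under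
  translation.\<close>

lemma (in group) left_translate_convolution:
  assumes "g \<in> carrier G"
  shows "left_translate G g (convolution G f h) = convolution G (left_translate G g f) h"
proof
  fix x
  show "left_translate G g (convolution G f h) x = convolution G (left_translate G g f) h x"
  proof (cases "x \<in> carrier G")
    case True
    have "left_translate G g (convolution G f h) x =
        (\<Sum>y\<in>carrier G. f y * h (inv y \<otimes> (inv g \<otimes> x)))"
      using True assms by (simp add: left_translate_def convolution_def)
    also have "\<dots> = (\<Sum>y\<in>carrier G. f (inv g \<otimes> y) * h (inv y \<otimes> x))"
      by (rule sum.reindex_bij_witness[of _ "\<lambda>y. inv g \<otimes> y" "\<lambda>y. g \<otimes> y"])
        (use assms True in \<open>auto simp: m_assoc[symmetric] inv_mult_group\<close>)
    also have "\<dots> = convolution G (left_translate G g f) h x"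
      using True by (simp add: left_translate_def convolution_def)
    finally show ?thesis .
  qed (simp add: left_translate_def convolution_def)
qed

lemma sum_apply_fun: "(\<Sum>x\<in>A. F x) y = (\<Sum>x\<in>A. F x y :: 'b :: comm_monoid_add)"
  by (induction A rule: infinite_finite_induct) auto

locale finite_submodule = group G for G (structure) +
  fixes V :: "('a \<Rightarrow> complex) set"
  assumes fin: "finite (carrier G)"
    and sub: "fun_space.subspace V"
    and supp: "\<And>f x. f \<in> V \<Longrightarrow> x \<notin> carrier G \<Longrightarrow> f x = 0"
    and inv: "\<And>f g. f \<in> V \<Longrightarrow> g \<in> carrier G \<Longrightarrow> left_translate G g f \<in> V"
begin

text \<open>Everything in \<open>V\<close> is supported on the finite carrier and so lies in the
  span of finitely many point functions. An independent spanning subset of \<open>V\<close> is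
  therefore finite, and the \<open>SOME\<close> in the definition has a witness.\<close>

lemma chosen_basis:
  "distinct (chosen_basis V)" "fun_space.independent (set (chosen_basis V))"
  "fun_space.span (set (chosen_basis V)) = V"
proof -
  define D where "D = (\<lambda>x y. if y = x then 1 else 0 :: complex) ` carrier G"
  have "V \<subseteq> fun_space.span D"
  proof
    fix f assume f: "f \<in> V"
    have "f = (\<Sum>x\<in>carrier G. fscale (f x) (\<lambda>y. if y = x then 1 else 0))"
    proof
      fix y
      show "f y = (\<Sum>x\<in>carrier G. fscale (f x) (\<lambda>y. if y = x then 1 else 0)) y"
        using f fin supp[of f y] by (simp add: sum_apply_fun fscale_def if_distrib cong: if_cong)
    qed
    also have "\<dots> \<in> fun_space.span D"
      by (intro fun_space.span_sum fun_space.span_scale fun_space.span_base) (auto simp: D_def)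
    finally show "f \<in> fun_space.span D" .
  qed
  moreover obtain B where B: "B \<subseteq> V" "fun_space.independent B" "V \<subseteq> fun_space.span B"
    using fun_space.maximal_independent_subset by blast
  ultimately have "finite B"
    using fun_space.independent_span_bound[of D B] fin by (auto simp: D_def)
  then obtain bs where "set bs = B" "distinct bs"
    using finite_distinct_list by blast
  moreover have "fun_space.span B = V"
    using B sub fun_space.span_minimal by blast
  ultimately have "\<exists>bs. distinct bs \<and> fun_space.independent (set bs) \<and> fun_space.span (set bs) = V"
    using B by blast
  from someI_ex[OF this] show "distinct (chosen_basis V)"
    "fun_space.independent (set (chosen_basis V))" "fun_space.span (set (chosen_basis V)) = V"
    unfolding chosen_basis_def by blast+
qed

lemma length_chosen_basis: "length (chosen_basis V) = fun_space.dim V"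
  using fun_space.dim_eq_card[of "set (chosen_basis V)" V] chosen_basis distinct_card
  by (metis fun_space.span_span)

lemma submodule_mat_carrier: "submodule_mat G V g \<in> carrier_mat (fun_space.dim V) (fun_space.dim V)"
  by (simp add: submodule_mat_def Let_def length_chosen_basis)

lemma submodule_mat_one: "submodule_mat G V \<one> = 1\<^sub>m (fun_space.dim V)"
proof -
  let ?bs = "chosen_basis V"
  have "left_translate G \<one> (?bs ! j) = ?bs ! j" if "j < length ?bs" for j
    using that chosen_basis(3) fun_space.span_base[of "?bs ! j" "set ?bs"] supp
    by (intro left_translate_one) auto
  moreover have "fun_space.representation (set ?bs) (?bs ! j) (?bs ! i) = (if i = j then 1 else 0)"
    if "i < length ?bs" "j < length ?bs" for i j
    using that chosen_basis by (simp add: fun_space.representation_basis nth_eq_iff_index_eq)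
  ultimately show ?thesis
    by (auto simp: submodule_mat_def Let_def length_chosen_basis)
qed

lemma submodule_mat_mult:
  assumes g: "g \<in> carrier G" and h: "h \<in> carrier G"
  shows "submodule_mat G V (g \<otimes> h) = submodule_mat G V g * submodule_mat G V h"
proof (rule eq_matI)
  let ?bs = "chosen_basis V"
  let ?R = "fun_space.representation (set ?bs)"
  let ?T = "left_translate G"
  note cb = chosen_basis
  fix i j
  assume "i < dim_row (submodule_mat G V g * submodule_mat G V h)"
    "j < dim_col (submodule_mat G V g * submodule_mat G V h)"
  then have ij: "i < length ?bs" "j < length ?bs"
    by (auto simp: submodule_mat_def Let_def)
  interpret T: Vector_Spaces.linear fscale fscale "?T g"
    by (rule linear_left_translate)
  have inV: "?T k (?bs ! l) \<in> V" if "k \<in> carrier G" "l < length ?bs" for k l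
    using that inv cb(3) fun_space.span_base[of "?bs ! l" "set ?bs"] by auto
  \<comment> \<open>Expand the translate by h in the basis, then push the translation by g through
    the sum by linearity; the coordinates are the entries of the matrix product.\<close>
  have "?T h (?bs ! j) = (\<Sum>b\<in>set ?bs. fscale (?R (?T h (?bs ! j)) b) b)"
    using fun_space.sum_representation_eq[OF cb(2), of "?T h (?bs ! j)" "set ?bs"] inV[OF h ij(2)] cb(3)
    by simp
  also have "\<dots> = (\<Sum>k<length ?bs. fscale (?R (?T h (?bs ! j)) (?bs ! k)) (?bs ! k))"
    using cb(1) by (simp add: sum.distinct_set_conv_list sum_list_sum_nth atLeast0LessThan)
  finally have e: "?T h (?bs ! j) = (\<Sum>k<length ?bs. fscale (?R (?T h (?bs ! j)) (?bs ! k)) (?bs ! k))" .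
  have "?T (g \<otimes> h) (?bs ! j) = ?T g (?T h (?bs ! j))"
    using left_translate_mult[OF g h] .
  also have "\<dots> = (\<Sum>k<length ?bs. fscale (?R (?T h (?bs ! j)) (?bs ! k)) (?T g (?bs ! k)))"
    by (subst e) (simp add: T.sum T.scale)
  finally have "?R (?T (g \<otimes> h) (?bs ! j)) (?bs ! i) =
      ?R (\<Sum>k<length ?bs. fscale (?R (?T h (?bs ! j)) (?bs ! k)) (?T g (?bs ! k))) (?bs ! i)"
    by simp
  also have "\<dots> = (\<Sum>k<length ?bs. ?R (?T h (?bs ! j)) (?bs ! k) * ?R (?T g (?bs ! k)) (?bs ! i))"
    using inV[OF g] cb sub
    by (subst fun_space.representation_sum)
      (auto simp: fun_space.representation_scale fun_space.subspace_scale intro!: sum.cong)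
  finally show "submodule_mat G V (g \<otimes> h) $$ (i, j) = (submodule_mat G V g * submodule_mat G V h) $$ (i, j)"
    using ij by (simp add: submodule_mat_def Let_def scalar_prod_def atLeast0LessThan mult.commute)
qed (auto simp: submodule_mat_def Let_def)

end

section \<open>Specht modules as representations of symmetric groups\<close>

lemma finite_carrier_sym_group: "finite (carrier (sym_group n))"
  by (simp add: sym_group_def finite_permutations)

lemma specht_submodule: "finite_submodule (sym_group (sum_list \<mu>)) (specht \<mu>)"
proof -
  interpret group "sym_group (sum_list \<mu>)" by (rule sym_group_is_group)
  show ?thesis
  proof unfold_locales
    show "finite (carrier (sym_group (sum_list \<mu>)))" by (rule finite_carrier_sym_group)
    show "fun_space.subspace (specht \<mu>)"
    proof (rule fun_space.subspaceI)
      have "convolution (sym_group (sum_list \<mu>)) 0 (young_symmetrizer \<mu>) = 0"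
        by (auto simp: convolution_def fun_eq_iff)
      then show "0 \<in> specht \<mu>"
        unfolding specht_def by (metis rangeI)
    next
      fix f f' assume "f \<in> specht \<mu>" "f' \<in> specht \<mu>"
      then show "f + f' \<in> specht \<mu>"
        unfolding specht_def by (auto simp: convolution_plus[symmetric])
    next
      fix c f assume "f \<in> specht \<mu>"
      then show "fscale c f \<in> specht \<mu>"
        unfolding specht_def by (auto simp: convolution_fscale[symmetric])
    qed
    fix f assume f: "f \<in> specht \<mu>"
    show "f x = 0" if "x \<notin> carrier (sym_group (sum_list \<mu>))" for x
      using f that by (auto simp: specht_def convolution_def)
    show "left_translate (sym_group (sum_list \<mu>)) g f \<in> specht \<mu>" if "g \<in> carrier (sym_group (sum_list \<mu>))" for g
      using f that by (auto simp: specht_def left_translate_convolution)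
  qed
qed

lemma rho_S_carrier: "rho_S \<mu> w \<in> carrier_mat (f_dim \<mu>) (f_dim \<mu>)"
  unfolding rho_S_def f_dim_def
  by (rule finite_submodule.submodule_mat_carrier[OF specht_submodule])

lemma rho_S_id: "rho_S \<mu> id = 1\<^sub>m (f_dim \<mu>)"
  unfolding rho_S_def f_dim_def
  using finite_submodule.submodule_mat_one[OF specht_submodule] by (simp add: sym_group_one)

lemma rho_S_comp:
  assumes "v permutes {1..sum_list \<mu>}" "w permutes {1..sum_list \<mu>}"
  shows "rho_S \<mu> (v \<circ> w) = rho_S \<mu> v * rho_S \<mu> w"
  unfolding rho_S_def
  using finite_submodule.submodule_mat_mult[OF specht_submodule, of v \<mu> w] assms
  by (simp add: sym_group_carrier sym_group_mult)

lemma chi_S_id: "chi_S \<mu> id = of_nat (f_dim \<mu>)"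
  by (simp add: chi_S_def rho_S_id)

text \<open>Two transpositions suffice: \<open>u\<close> sends a to p, and the second one corrects
  the image of c. It leaves p alone because p differs from both \<open>u c\<close> and q.\<close>

lemma permutes_two_points:
  assumes "a \<in> S" "c \<in> S" "p \<in> S" "q \<in> S" "a \<noteq> c" "p \<noteq> q"
  obtains w where "w permutes S" "w a = p" "w c = q"
proof -
  define u where "u = Transposition.transpose a p"
  define w where "w = Transposition.transpose (u c) q \<circ> u"
  have u: "u permutes S"
    unfolding u_def using assms by (intro permutes_swap_id)
  then have "u c \<in> S"
    using assms by (subst permutes_in_image)
  then have "w permutes S"
    unfolding w_def using u assms by (intro permutes_compose permutes_swap_id)
  moreover have "u c \<noteq> p"
    using assms by (auto simp: u_def Transposition.transpose_def)
  then have "w a = p" "w c = q"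
    using assms by (auto simp: w_def u_def)
  ultimately show thesis using that by blast
qed

text \<open>A character is a class function and all transpositions are conjugate. This is needed
  because a conjugate of (1 2), relabelled inside a block, swaps an arbitrary pair of
  points.\<close>

lemma chi_S_transpose:
  assumes "p \<in> {1..sum_list \<mu>}" "q \<in> {1..sum_list \<mu>}" "p \<noteq> q"
  shows "chi_S \<mu> (Transposition.transpose p q) = chi_S \<mu> (Transposition.transpose 1 2)"
proof -
  have n: "sum_list \<mu> \<ge> 2" using assms by auto
  obtain w where w: "w permutes {1..sum_list \<mu>}" "w 1 = p" "w 2 = q"
    using permutes_two_points[of 1 "{1..sum_list \<mu>}" 2 p q] assms n by auto
  have inj: "w x = w y \<longleftrightarrow> x = y" for x y
    using w(1) by (metis permutes_inj injD)
  have "Transposition.transpose p q \<circ> w = w \<circ> Transposition.transpose 1 2"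
    by (auto simp: fun_eq_iff Transposition.transpose_def w(2,3)[symmetric] inj)
  then have e: "Transposition.transpose p q = w \<circ> (Transposition.transpose 1 2 \<circ> inv' w)"
    using permutes_inv_o(1)[OF w(1)] by (metis comp_assoc comp_id)
  have s: "Transposition.transpose 1 2 permutes {1..sum_list \<mu>}"
    using n by (intro permutes_swap_id) auto
  note iw = permutes_inv[OF w(1)]
  have "chi_S \<mu> (Transposition.transpose p q) =
      mat_trace (rho_S \<mu> w * (rho_S \<mu> (Transposition.transpose 1 2) * rho_S \<mu> (inv' w)))"
    unfolding chi_S_def e by (simp add: rho_S_comp w s iw permutes_compose del: One_nat_def)
  also have "\<dots> = mat_trace ((rho_S \<mu> (Transposition.transpose 1 2) * rho_S \<mu> (inv' w)) * rho_S \<mu> w)"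
    by (rule mat_trace_mult_commute[of _ "f_dim \<mu>"]) (auto intro: rho_S_carrier mult_carrier_mat)
  also have "\<dots> = mat_trace (rho_S \<mu> (Transposition.transpose 1 2 \<circ> inv' w \<circ> w))"
    by (simp add: rho_S_comp w s iw permutes_compose del: One_nat_def)
  also have "\<dots> = chi_S \<mu> (Transposition.transpose 1 2)"
    unfolding chi_S_def comp_assoc permutes_inv_o(2)[OF w(1)] by simp
  finally show ?thesis .
qed

subsection \<open>Induced representations\<close>

text \<open>Multiplicativity is asked for on \<open>H\<close> only: \<open>block_tensor\<close> is a
  total function and need not be multiplicative on pairs that move the blocks.\<close>

locale finite_induction = group G for G (structure) +
  fixes H :: "'a set" and d :: nat and \<sigma> :: "'a \<Rightarrow> complex mat"
  assumes fin: "finite (carrier G)"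
    and subgrp: "subgroup H G"
    and carrier_\<sigma>: "\<And>h. h \<in> H \<Longrightarrow> \<sigma> h \<in> carrier_mat d d"
    and one_\<sigma>: "\<sigma> \<one> = 1\<^sub>m d"
    and mult_\<sigma>: "\<And>g h. g \<in> H \<Longrightarrow> h \<in> H \<Longrightarrow> \<sigma> (g \<otimes> h) = \<sigma> g * \<sigma> h"
begin

definition ts where "ts = chosen_transversal G H"

lemma mem_H [simp]: "h \<in> H \<Longrightarrow> h \<in> carrier G"
  using subgroup.mem_carrier[OF subgrp] .

lemma mem_lcoset_iff:
  assumes "t \<in> carrier G" "g \<in> carrier G"
  shows "g \<in> t <# H \<longleftrightarrow> inv t \<otimes> g \<in> H"
proof
  assume "g \<in> t <# H"
  then obtain h where "h \<in> H" "g = t \<otimes> h" by (auto simp: l_coset_def)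
  then show "inv t \<otimes> g \<in> H" using assms by (simp add: m_assoc[symmetric])
next
  assume "inv t \<otimes> g \<in> H"
  moreover have "g = t \<otimes> (inv t \<otimes> g)" using assms by (simp add: m_assoc[symmetric])
  ultimately show "g \<in> t <# H" by (auto simp: l_coset_def)
qed

text \<open>One representative from each left coset witnesses the \<open>SOME\<close> in
  \<open>chosen_transversal\<close>. Coset membership is restated through the inverse of the
  representative, the form in which \<open>induced_mat\<close> tests it.\<close>

lemma ts:
  shows ts_carrier: "i < length ts \<Longrightarrow> ts ! i \<in> carrier G"
    and ts_unique: "g \<in> carrier G \<Longrightarrow> \<exists>!i. i < length ts \<and> inv (ts ! i) \<otimes> g \<in> H"
proof -
  define C where "C = (\<lambda>g. g <# H) ` carrier G"
  have "finite C" using fin by (simp add: C_def)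
  then obtain cs where cs: "set cs = C" "distinct cs"
    using finite_distinct_list by blast
  define rep where "rep c = (SOME g. g \<in> carrier G \<and> g <# H = c)" for c
  have rep: "rep c \<in> carrier G \<and> rep c <# H = c" if "c \<in> C" for c
    unfolding rep_def by (rule someI_ex) (use that in \<open>auto simp: C_def\<close>)
  have self: "g \<in> g <# H" if "g \<in> carrier G" for g
    using that subgroup.one_closed[OF subgrp] by (force simp: l_coset_def)
  have mem: "g \<in> rep c <# H \<longleftrightarrow> c = g <# H" if "c \<in> C" "g \<in> carrier G" for g c
    using rep[OF that(1)] that l_repr_independence[OF _ _ subgrp, of g "rep c"] self[OF that(2)]
    by auto
  have "\<exists>!i. i < length (map rep cs) \<and> g \<in> (map rep cs ! i) <# H" if g: "g \<in> carrier G" for g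
  proof -
    have "g <# H \<in> set cs" using g cs by (auto simp: C_def)
    then obtain i where i: "i < length cs" "cs ! i = g <# H"
      by (auto simp: in_set_conv_nth)
    moreover have "g \<in> (map rep cs ! j) <# H \<longleftrightarrow> cs ! j = g <# H" if "j < length cs" for j
      using that mem[OF _ g, of "cs ! j"] cs(1) nth_mem[OF that] by simp
    ultimately show ?thesis
      using cs(2) by (metis length_map nth_eq_iff_index_eq)
  qed
  then have "\<exists>ts. set ts \<subseteq> carrier G \<and> (\<forall>g\<in>carrier G. \<exists>!i. i < length ts \<and> g \<in> (ts ! i) <# H)"
    using rep cs by (intro exI[of _ "map rep cs"]) auto
  from someI_ex[OF this]
  have *: "set ts \<subseteq> carrier G" "\<And>g. g \<in> carrier G \<Longrightarrow> \<exists>!i. i < length ts \<and> g \<in> (ts ! i) <# H"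
    unfolding ts_def chosen_transversal_def by blast+
  show c: "ts ! i \<in> carrier G" if "i < length ts" for i using * that by auto
  show "\<exists>!i. i < length ts \<and> inv (ts ! i) \<otimes> g \<in> H" if "g \<in> carrier G"
    using *(2)[OF that] mem_lcoset_iff[OF c that] by auto
qed

definition S where "S h p q = (if h \<in> H then \<sigma> h $$ (p, q) else 0)"

lemma induced_mat_eq: "induced_mat G H \<sigma> g = mat (length ts * d) (length ts * d)
    (\<lambda>(i, j). S (inv (ts ! (i div d)) \<otimes> g \<otimes> ts ! (j div d)) (i mod d) (j mod d))"
  by (simp add: induced_mat_def one_\<sigma> ts_def S_def Let_def)

lemma induced_mat_carrier: "induced_mat G H \<sigma> g \<in> carrier_mat (length ts * d) (length ts * d)"
  by (simp add: induced_mat_eq)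

lemma block_index:
  assumes "i < length ts * d"
  shows "d > 0" "i div d < length ts" "i mod d < d"
  using assms by (cases d; auto simp: less_mult_imp_div_less)+

lemma induced_mat_one: "induced_mat G H \<sigma> \<one> = 1\<^sub>m (length ts * d)"
proof (rule eq_matI)
  fix i j assume "i < dim_row (1\<^sub>m (length ts * d))" "j < dim_col (1\<^sub>m (length ts * d))"
  then have ij: "i < length ts * d" "j < length ts * d" by auto
  note bi = block_index[OF ij(1)] and bj = block_index[OF ij(2)]
  have "inv (ts ! (i div d)) \<otimes> ts ! (j div d) \<in> H \<longleftrightarrow> i div d = j div d"
    using ts_unique[OF ts_carrier[OF bj(2)]] bi bj subgroup.one_closed[OF subgrp] ts_carrier
    by (metis l_inv)
  moreover have "i div d = j div d \<and> i mod d = j mod d \<longleftrightarrow> i = j"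
    by (metis div_mult_mod_eq)
  ultimately show "induced_mat G H \<sigma> \<one> $$ (i, j) = 1\<^sub>m (length ts * d) $$ (i, j)"
    using ij bi bj ts_carrier by (auto simp: induced_mat_eq S_def one_\<sigma>)
qed (auto simp: induced_mat_eq)

text \<open>For a fixed column representative u, exactly one representative \<open>ts ! a\<close>
  lies in the coset of h u, so a single block survives in the sum over the inner index. It is
  \<sigma>(l) \<sigma>(k) with l k = t^-1 g h u, and since k lies in \<open>H\<close>, l lies in
  \<open>H\<close> exactly when l k does.\<close>

lemma induced_mat_mult:
  assumes g: "g \<in> carrier G" and h: "h \<in> carrier G"
  shows "induced_mat G H \<sigma> (g \<otimes> h) = induced_mat G H \<sigma> g * induced_mat G H \<sigma> h"
proof (rule eq_matI)
  fix i j assume "i < dim_row (induced_mat G H \<sigma> g * induced_mat G H \<sigma> h)"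
    "j < dim_col (induced_mat G H \<sigma> g * induced_mat G H \<sigma> h)"
  then have ij: "i < length ts * d" "j < length ts * d" by (auto simp: induced_mat_eq)
  note bi = block_index[OF ij(1)] and bj = block_index[OF ij(2)]
  define p q where pq: "p = i mod d" "q = j mod d"
  define t u where tu: "t = ts ! (i div d)" "u = ts ! (j div d)"
  have tuc: "t \<in> carrier G" "u \<in> carrier G" using bi bj ts_carrier by (auto simp: tu)
  obtain a where a: "a < length ts" "inv (ts ! a) \<otimes> (h \<otimes> u) \<in> H"
    and un: "\<And>b. b < length ts \<Longrightarrow> inv (ts ! b) \<otimes> (h \<otimes> u) \<in> H \<Longrightarrow> b = a"
    using ts_unique[of "h \<otimes> u"] h tuc by auto
  define k where "k = inv (ts ! a) \<otimes> h \<otimes> u"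
  define l where "l = inv t \<otimes> g \<otimes> ts ! a"
  have ac: "ts ! a \<in> carrier G" using a ts_carrier by auto
  have k: "k \<in> H" using a ac h tuc by (simp add: k_def m_assoc)
  have lc: "l \<in> carrier G" using ac g tuc by (simp add: l_def)
  have "l \<otimes> k = inv t \<otimes> g \<otimes> (ts ! a \<otimes> (inv (ts ! a) \<otimes> (h \<otimes> u)))"
    using tuc g h ac by (simp add: l_def k_def m_assoc)
  also have "ts ! a \<otimes> (inv (ts ! a) \<otimes> (h \<otimes> u)) = h \<otimes> u"
    using ac h tuc by (simp add: m_assoc[symmetric])
  finally have lk: "inv t \<otimes> (g \<otimes> h) \<otimes> u = l \<otimes> k"
    using tuc g h by (simp add: m_assoc)
  have lH: "l \<otimes> k \<in> H \<longleftrightarrow> l \<in> H"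
  proof
    assume "l \<otimes> k \<in> H"
    then have "l \<otimes> k \<otimes> inv k \<in> H"
      using k subgrp by (simp add: subgroup.m_closed subgroup.m_inv_closed)
    then show "l \<in> H" using lc k by (simp add: m_assoc)
  qed (use k subgrp in \<open>simp add: subgroup.m_closed\<close>)
  have "(induced_mat G H \<sigma> g * induced_mat G H \<sigma> h) $$ (i, j) =
    (\<Sum>x<length ts * d. S (inv t \<otimes> g \<otimes> ts ! (x div d)) p (x mod d) *
      S (inv (ts ! (x div d)) \<otimes> h \<otimes> u) (x mod d) q)"
    using ij by (auto simp: induced_mat_eq scalar_prod_def atLeast0LessThan pq tu intro!: sum.cong)
  also have "\<dots> = (\<Sum>b<length ts. \<Sum>y<d. S (inv t \<otimes> g \<otimes> ts ! b) p y * S (inv (ts ! b) \<otimes> h \<otimes> u) y q)"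
    by (rule sum_divmod)
  also have "\<dots> = (\<Sum>b<length ts. if b = a then \<Sum>y<d. S l p y * S k y q else 0)"
  proof (rule sum.cong[OF refl])
    fix b assume b: "b \<in> {..<length ts}"
    then have "inv (ts ! b) \<otimes> h \<otimes> u \<notin> H" if "b \<noteq> a"
      using un[of b] that h tuc ts_carrier by (auto simp: m_assoc)
    then show "(\<Sum>y<d. S (inv t \<otimes> g \<otimes> ts ! b) p y * S (inv (ts ! b) \<otimes> h \<otimes> u) y q) =
        (if b = a then \<Sum>y<d. S l p y * S k y q else 0)"
      by (auto simp: l_def k_def S_def)
  qed
  also have "\<dots> = (\<Sum>y<d. S l p y * S k y q)"
    using a by simp
  also have "\<dots> = S (l \<otimes> k) p q"
  proof (cases "l \<in> H")
    case True
    have "\<sigma> l \<in> carrier_mat d d" "\<sigma> k \<in> carrier_mat d d" using carrier_\<sigma> True k by auto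
    then show ?thesis
      using True k lH bi bj mult_\<sigma>[OF True k]
      by (simp add: S_def scalar_prod_def atLeast0LessThan pq)
  qed (use lH in \<open>simp add: S_def\<close>)
  finally show "induced_mat G H \<sigma> (g \<otimes> h) $$ (i, j) = (induced_mat G H \<sigma> g * induced_mat G H \<sigma> h) $$ (i, j)"
    using ij lk by (simp add: induced_mat_eq pq tu)
qed (auto simp: induced_mat_eq)

definition \<chi> where "\<chi> h = (if h \<in> H then mat_trace (\<sigma> h) else 0)"

lemma \<chi>_conj:
  assumes g: "g \<in> carrier G" and h: "h \<in> H"
  shows "\<chi> (inv h \<otimes> g \<otimes> h) = \<chi> g"
proof -
  have ih: "inv h \<in> H" using h subgrp by (simp add: subgroup.m_inv_closed)
  have e: "g = h \<otimes> (inv h \<otimes> g \<otimes> h) \<otimes> inv h"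
    using g h by (simp add: m_assoc[symmetric]) (simp add: m_assoc)
  have "inv h \<otimes> g \<otimes> h \<in> H \<longleftrightarrow> g \<in> H"
    using e h ih subgroup.m_closed[OF subgrp] by metis
  moreover have "mat_trace (\<sigma> (inv h \<otimes> g \<otimes> h)) = mat_trace (\<sigma> g)" if "g \<in> H"
  proof -
    have "mat_trace (\<sigma> (inv h \<otimes> g \<otimes> h)) = mat_trace (\<sigma> (inv h \<otimes> g) * \<sigma> h)"
      using that h ih subgrp by (simp add: mult_\<sigma> subgroup.m_closed)
    also have "\<dots> = mat_trace (\<sigma> h * \<sigma> (inv h \<otimes> g))"
      using that h ih subgrp by (intro mat_trace_mult_commute[of _ d] carrier_\<sigma>) (auto simp: subgroup.m_closed)
    also have "\<dots> = mat_trace (\<sigma> (h \<otimes> (inv h \<otimes> g)))"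
      using that h ih subgrp by (simp add: mult_\<sigma> subgroup.m_closed)
    also have "h \<otimes> (inv h \<otimes> g) = g"
      using g h by (simp add: m_assoc[symmetric])
    finally show ?thesis .
  qed
  ultimately show ?thesis by (simp add: \<chi>_def)
qed

text \<open>Frobenius' formula. Every group element is uniquely \<open>ts ! i\<close> times some h
  in \<open>H\<close>, and by \<open>\<chi>_conj\<close> the summand does not depend on h, so each
  diagonal block is counted \<open>card H\<close> times.\<close>

lemma mat_trace_induced:
  assumes g: "g \<in> carrier G"
  shows "of_nat (card H) * mat_trace (induced_mat G H \<sigma> g) = (\<Sum>t\<in>carrier G. \<chi> (inv t \<otimes> g \<otimes> t))"
proof -
  have bij: "bij_betw (\<lambda>(i, h). ts ! i \<otimes> h) ({..<length ts} \<times> H) (carrier G)"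
  proof (rule bij_betwI')
    fix x y assume "x \<in> {..<length ts} \<times> H" "y \<in> {..<length ts} \<times> H"
    then obtain i h j k where xy: "x = (i, h)" "y = (j, k)" "i < length ts" "j < length ts" "h \<in> H" "k \<in> H"
      by auto
    have *: "i = j" if "ts ! i \<otimes> h = ts ! j \<otimes> k"
    proof -
      have "inv (ts ! i) \<otimes> (ts ! i \<otimes> h) \<in> H"
        using xy ts_carrier by (simp add: m_assoc[symmetric])
      moreover have "inv (ts ! j) \<otimes> (ts ! i \<otimes> h) \<in> H"
        unfolding that using xy ts_carrier by (simp add: m_assoc[symmetric])
      ultimately show ?thesis
        using ts_unique[of "ts ! i \<otimes> h"] xy ts_carrier by auto
    qed
    show "((case x of (i, h) \<Rightarrow> ts ! i \<otimes> h) = (case y of (i, h) \<Rightarrow> ts ! i \<otimes> h)) = (x = y)"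
      using * xy ts_carrier by auto
  next
    fix x assume "x \<in> {..<length ts} \<times> H"
    then show "(case x of (i, h) \<Rightarrow> ts ! i \<otimes> h) \<in> carrier G"
      using ts_carrier by auto
  next
    fix y assume y: "y \<in> carrier G"
    then obtain i where "i < length ts" "inv (ts ! i) \<otimes> y \<in> H"
      using ts_unique by blast
    moreover from this have "y = ts ! i \<otimes> (inv (ts ! i) \<otimes> y)"
      using y ts_carrier by (simp add: m_assoc[symmetric])
    ultimately show "\<exists>x\<in>{..<length ts} \<times> H. y = (case x of (i, h) \<Rightarrow> ts ! i \<otimes> h)"
      by (intro bexI[of _ "(i, inv (ts ! i) \<otimes> y)"]) auto
  qed
  have "mat_trace (induced_mat G H \<sigma> g) = (\<Sum>i<length ts * d.
      S (inv (ts ! (i div d)) \<otimes> g \<otimes> ts ! (i div d)) (i mod d) (i mod d))"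
    by (simp add: mat_trace_def induced_mat_eq)
  also have "\<dots> = (\<Sum>i<length ts. \<Sum>p<d. S (inv (ts ! i) \<otimes> g \<otimes> ts ! i) p p)"
    by (rule sum_divmod)
  also have "\<dots> = (\<Sum>i<length ts. \<chi> (inv (ts ! i) \<otimes> g \<otimes> ts ! i))"
  proof (rule sum.cong[OF refl])
    fix i
    have "(\<Sum>p<d. S x p p) = \<chi> x" for x
      using carrier_\<sigma>[of x] by (auto simp: S_def \<chi>_def mat_trace_def)
    then show "(\<Sum>p<d. S (inv (ts ! i) \<otimes> g \<otimes> ts ! i) p p) = \<chi> (inv (ts ! i) \<otimes> g \<otimes> ts ! i)" .
  qed
  finally have tr: "mat_trace (induced_mat G H \<sigma> g) = (\<Sum>i<length ts. \<chi> (inv (ts ! i) \<otimes> g \<otimes> ts ! i))" .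
  have "(\<Sum>t\<in>carrier G. \<chi> (inv t \<otimes> g \<otimes> t)) =
      (\<Sum>(i, h)\<in>{..<length ts} \<times> H. \<chi> (inv (ts ! i \<otimes> h) \<otimes> g \<otimes> (ts ! i \<otimes> h)))"
    by (subst sum.reindex_bij_betw[OF bij, symmetric]) (auto intro!: sum.cong)
  also have "\<dots> = (\<Sum>i<length ts. \<Sum>h\<in>H. \<chi> (inv (ts ! i \<otimes> h) \<otimes> g \<otimes> (ts ! i \<otimes> h)))"
    by (rule sum.cartesian_product[symmetric])
  also have "\<dots> = (\<Sum>i<length ts. \<Sum>h\<in>H. \<chi> (inv (ts ! i) \<otimes> g \<otimes> ts ! i))"
  proof (intro sum.cong refl)
    fix i h assume "i \<in> {..<length ts}" and h: "h \<in> H"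
    then have i: "ts ! i \<in> carrier G" using ts_carrier by auto
    have "inv (ts ! i \<otimes> h) \<otimes> g \<otimes> (ts ! i \<otimes> h) = inv h \<otimes> (inv (ts ! i) \<otimes> g \<otimes> ts ! i) \<otimes> h"
      using i h g by (simp add: inv_mult_group m_assoc)
    then show "\<chi> (inv (ts ! i \<otimes> h) \<otimes> g \<otimes> (ts ! i \<otimes> h)) = \<chi> (inv (ts ! i) \<otimes> g \<otimes> ts ! i)"
      using \<chi>_conj[OF _ h] i g by simp
  qed
  finally show ?thesis
    by (simp add: tr sum_distrib_left)
qed

end

subsection \<open>The group operations of G(n,r) and its block subgroups\<close>

lemma carrier_Gnr:
  assumes "r > 0"
  shows "(x, w) \<in> carrier (Gnr n r) \<longleftrightarrow> x \<in> {1..n} \<rightarrow>\<^sub>E {0..<int r} \<and> w permutes {1..n}"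
  using assms by (simp add: Gnr_def Zpow_def carrier_integer_mod_group sym_group_carrier)

lemma mult_Gnr:
  assumes "w permutes {1..n}"
  shows "(x, w) \<otimes>\<^bsub>Gnr n r\<^esub> (y, v) = (\<lambda>i\<in>{1..n}. (x i + y (inv' w i)) mod int r, w \<circ> v)"
  using assms by (auto simp: Gnr_def Zpow_def permute_coords_def sym_group_carrier sym_group_mult fun_eq_iff)

lemma one_Gnr: "\<one>\<^bsub>Gnr n r\<^esub> = (\<lambda>i\<in>{1..n}. 0, id)"
  by (simp add: Gnr_def Zpow_def sym_group_one)

lemma finite_carrier_Gnr:
  assumes "r > 0"
  shows "finite (carrier (Gnr n r))"
  using assms by (auto simp: Gnr_def Zpow_def carrier_integer_mod_group finite_carrier_sym_group finite_PiE)

text \<open>The inverse of (x;w) is (-(w^-1 x); w^-1), and coordinate i of w^-1 x is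
  \<open>x (w i)\<close>.\<close>

lemma l_inv_Gnr:
  assumes "r > 0" "(x, w) \<in> carrier (Gnr n r)"
  shows "(\<lambda>i\<in>{1..n}. (- x (w i)) mod int r, inv' w) \<in> carrier (Gnr n r)"
    and "(\<lambda>i\<in>{1..n}. (- x (w i)) mod int r, inv' w) \<otimes>\<^bsub>Gnr n r\<^esub> (x, w) = \<one>\<^bsub>Gnr n r\<^esub>"
proof -
  have w: "w permutes {1..n}" using assms carrier_Gnr by simp
  show "(\<lambda>i\<in>{1..n}. (- x (w i)) mod int r, inv' w) \<in> carrier (Gnr n r)"
    using assms permutes_inv[OF w] by (auto simp: carrier_Gnr)
  show "(\<lambda>i\<in>{1..n}. (- x (w i)) mod int r, inv' w) \<otimes>\<^bsub>Gnr n r\<^esub> (x, w) = \<one>\<^bsub>Gnr n r\<^esub>"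
    using permutes_inv_o(2)[OF w]
    by (auto simp: mult_Gnr[OF permutes_inv[OF w]] one_Gnr permutes_inv_inv[OF w] mod_simps)
qed

lemma group_Gnr:
  assumes "r > 0"
  shows "group (Gnr n r)"
proof (rule groupI)
  let ?G = "Gnr n r"
  show "\<one>\<^bsub>?G\<^esub> \<in> carrier ?G"
    using assms by (auto simp: one_Gnr carrier_Gnr permutes_id)
  fix g assume g: "g \<in> carrier ?G"
  obtain x w where gx: "g = (x, w)" by (cases g)
  have w: "w permutes {1..n}" and x: "x \<in> {1..n} \<rightarrow>\<^sub>E {0..<int r}"
    using g assms carrier_Gnr by (auto simp: gx)
  show "\<one>\<^bsub>?G\<^esub> \<otimes>\<^bsub>?G\<^esub> g = g"
    using x by (auto simp: one_Gnr gx mult_Gnr permutes_id fun_eq_iff PiE_iff extensional_def)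
  show "\<exists>h\<in>carrier ?G. h \<otimes>\<^bsub>?G\<^esub> g = \<one>\<^bsub>?G\<^esub>"
    using l_inv_Gnr[OF assms] g gx by blast
  fix h assume h: "h \<in> carrier ?G"
  obtain y v where hy: "h = (y, v)" by (cases h)
  have v: "v permutes {1..n}" and y: "y \<in> {1..n} \<rightarrow>\<^sub>E {0..<int r}"
    using h assms carrier_Gnr by (auto simp: hy)
  have wv: "w \<circ> v permutes {1..n}"
    using v w by (rule permutes_compose)
  show "g \<otimes>\<^bsub>?G\<^esub> h \<in> carrier ?G"
    using wv assms by (auto simp: gx hy mult_Gnr[OF w] carrier_Gnr)
  fix k assume "k \<in> carrier ?G"
  obtain z u where kz: "k = (z, u)" by (cases k)
  have "inv' (w \<circ> v) i = inv' v (inv' w i)" for i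
    using o_inv_distrib[OF permutes_bij[OF w] permutes_bij[OF v]] by simp
  moreover have "inv' w i \<in> {1..n}" if "i \<in> {1..n}" for i
    using permutes_in_image[OF permutes_inv[OF w]] that by blast
  ultimately show "g \<otimes>\<^bsub>?G\<^esub> h \<otimes>\<^bsub>?G\<^esub> k = g \<otimes>\<^bsub>?G\<^esub> (h \<otimes>\<^bsub>?G\<^esub> k)"
    by (auto simp: gx hy kz mult_Gnr[OF w] mult_Gnr[OF v] mult_Gnr[OF wv] fun_eq_iff mod_simps add.assoc)
qed

lemma inv_Gnr:
  assumes "r > 0" "(x, w) \<in> carrier (Gnr n r)"
  shows "inv\<^bsub>Gnr n r\<^esub> (x, w) = (\<lambda>i\<in>{1..n}. (- x (w i)) mod int r, inv' w)"
  using l_inv_Gnr[OF assms] assms group.inv_equality[OF group_Gnr] by metis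

lemma powi_mod_cong:
  fixes \<zeta> :: complex
  assumes "\<zeta> ^ r = 1" "r > 0" "k mod int r = l mod int r"
  shows "\<zeta> powi k = \<zeta> powi l"
proof -
  have nz: "\<zeta> \<noteq> 0" using assms by (metis power_eq_0_iff zero_neq_one)
  have "\<zeta> powi k = \<zeta> powi (int r * (k div int r) + k mod int r)" for k
    by simp
  also have "\<dots> k = \<zeta> powi (k mod int r)" for k
    using nz assms(1) by (subst power_int_add) (auto simp: power_int_mult)
  finally show ?thesis using assms(3) by metis
qed

text \<open>On a set stable under w the twist by w merely reorders the summands of y. Hence the
  exponent of \<zeta> belonging to a block is additive modulo r on the block subgroup.\<close>

lemma sum_twisted_mod:
  fixes x y :: "nat \<Rightarrow> int"
  assumes "w permutes A" "B \<subseteq> A" "w ` B = B"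
  shows "(\<Sum>i\<in>B. (x i + y (inv' w i)) mod m) mod m = (sum x B + sum y B) mod m"
proof -
  have "inj_on (inv' w) B"
    using permutes_inj[OF permutes_inv[OF assms(1)]] inj_on_subset by blast
  moreover have "inv' w ` B = B"
    using image_inv_f_f[OF permutes_inj[OF assms(1)], of B] assms(3) by simp
  ultimately have "(\<Sum>i\<in>B. y (inv' w i)) = sum y B"
    using sum.reindex[of "inv' w" B y] by simp
  then show ?thesis
    by (simp add: mod_sum_eq sum.distrib)
qed

section \<open>Consecutive blocks and their stabilizer\<close>

definition block :: "nat list \<Rightarrow> nat \<Rightarrow> nat set" where
  "block b k = {block_off b k + 1 .. block_off b k + b ! k}"

text \<open>The permutation component of \<open>block_part\<close>, separated so that it can be fed
  to \<open>rho_S\<close> without the coordinates in \<open>Zpow\<close>.\<close>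

definition block_perm :: "nat list \<Rightarrow> nat \<Rightarrow> (nat \<Rightarrow> nat) \<Rightarrow> nat \<Rightarrow> nat" where
  "block_perm b k w = (\<lambda>i. if i \<in> {1..b ! k} then w (block_off b k + i) - block_off b k else i)"

lemma block_off_Suc: "k < length b \<Longrightarrow> block_off b (Suc k) = block_off b k + b ! k"
  by (simp add: block_off_def take_Suc_conv_app_nth)

lemma block_off_mono: "j \<le> k \<Longrightarrow> block_off b j \<le> block_off b k"
proof -
  assume "j \<le> k"
  then have "take k b = take j b @ take (k - j) (drop j b)"
    by (metis le_add_diff_inverse take_add)
  then show ?thesis by (simp add: block_off_def)
qed

lemma card_block [simp]: "card (block b k) = b ! k"
  by (simp add: block_def)

lemma block_disjoint:
  assumes "j < length b" "k < length b" "j \<noteq> k"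
  shows "block b j \<inter> block b k = {}"
proof -
  have "block b j \<inter> block b k = {}" if "j < k" "k < length b" for j k
  proof -
    have "block_off b j + b ! j \<le> block_off b k"
      using that block_off_mono[of "Suc j" k b] by (simp add: block_off_Suc)
    then show ?thesis by (auto simp: block_def)
  qed
  then show ?thesis
    using assms by (metis Int_commute nat_neq_iff)
qed

lemma UN_block_lessThan: "m \<le> length b \<Longrightarrow> (\<Union>k<m. block b k) = {1..block_off b m}"
proof (induction m)
  case (Suc m)
  then show ?case
    by (auto simp: lessThan_Suc block_off_Suc block_def)
qed (simp add: block_off_def)

lemma UN_block: "(\<Union>k<length b. block b k) = {1..sum_list b}"
  using UN_block_lessThan[of "length b" b] by (simp add: block_off_def)

lemma block_subset: "k < length b \<Longrightarrow> block b k \<subseteq> {1..sum_list b}"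
  using UN_block by blast

lemma mem_block_subgroup:
  "(x, w) \<in> block_subgroup b r \<longleftrightarrow>
    (x, w) \<in> carrier (Gnr (sum_list b) r) \<and> (\<forall>k<length b. w ` block b k = block b k)"
  by (auto simp: block_subgroup_def block_def)

lemma subgroup_block:
  assumes "r > 0"
  shows "subgroup (block_subgroup b r) (Gnr (sum_list b) r)"
proof -
  let ?G = "Gnr (sum_list b) r"
  interpret group ?G using assms by (rule group_Gnr)
  show ?thesis
  proof (rule subgroupI)
    show "block_subgroup b r \<subseteq> carrier ?G"
      using mem_block_subgroup by auto
    have "\<one>\<^bsub>?G\<^esub> \<in> block_subgroup b r"
      using one_closed by (simp add: one_Gnr mem_block_subgroup del: One_nat_def)
    then show "block_subgroup b r \<noteq> {}" by auto
  next
    fix g assume g: "g \<in> block_subgroup b r"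
    obtain x w where gx: "g = (x, w)" by (cases g)
    have gc: "(x, w) \<in> carrier ?G" and wk: "\<And>k. k < length b \<Longrightarrow> w ` block b k = block b k"
      using g by (auto simp: gx mem_block_subgroup)
    then have w: "w permutes {1..sum_list b}" using carrier_Gnr assms by simp
    have "inv' w ` block b k = block b k" if "k < length b" for k
      using image_inv_f_f[OF permutes_inj[OF w], of "block b k"] wk[OF that] by simp
    then show "inv\<^bsub>?G\<^esub> g \<in> block_subgroup b r"
      using inv_closed[OF gc] unfolding gx inv_Gnr[OF assms gc] mem_block_subgroup by blast
    fix h assume h: "h \<in> block_subgroup b r"
    obtain y v where hy: "h = (y, v)" by (cases h)
    have hc: "(y, v) \<in> carrier ?G" and vk: "\<And>k. k < length b \<Longrightarrow> v ` block b k = block b k"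
      using h by (auto simp: hy mem_block_subgroup)
    show "g \<otimes>\<^bsub>?G\<^esub> h \<in> block_subgroup b r"
      using m_closed[OF gc hc] wk vk unfolding gx hy mult_Gnr[OF w] mem_block_subgroup
      by (metis image_comp)
  qed
qed

lemma block_perm_permutes:
  assumes "w permutes A" "w ` block b k = block b k"
  shows "block_perm b k w permutes {1..b ! k}"
proof (rule bij_imp_permutes)
  let ?o = "block_off b k"
  have *: "w (?o + i) \<in> block b k" if "i \<in> {1..b ! k}" for i
    using assms(2) that by (force simp: block_def)
  have inj: "inj_on (block_perm b k w) {1..b ! k}"
  proof (rule inj_onI)
    fix i j assume ij: "i \<in> {1..b ! k}" "j \<in> {1..b ! k}" and e: "block_perm b k w i = block_perm b k w j"
    then have "w (?o + i) = w (?o + j)"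
      using *[of i] *[of j] by (auto simp: block_perm_def block_def)
    then show "i = j"
      using injD[OF permutes_inj[OF assms(1)], of "?o + i" "?o + j"] by simp
  qed
  moreover have "block_perm b k w ` {1..b ! k} \<subseteq> {1..b ! k}"
    using * by (force simp: block_perm_def block_def)
  ultimately show "bij_betw (block_perm b k w) {1..b ! k} {1..b ! k}"
    by (simp add: bij_betw_def endo_inj_surj)
  show "block_perm b k w i = i" if "i \<notin> {1..b ! k}" for i
    using that unfolding block_perm_def by (rule if_not_P)
qed

lemma block_perm_comp:
  assumes "v ` block b k = block b k"
  shows "block_perm b k (w \<circ> v) = block_perm b k w \<circ> block_perm b k v"
proof
  fix i
  have "v (block_off b k + i) \<in> block b k" if "i \<in> {1..b ! k}"
    using assms that by (force simp: block_def)
  then show "block_perm b k (w \<circ> v) i = (block_perm b k w \<circ> block_perm b k v) i"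
    by (auto simp: block_perm_def block_def)
qed

lemma block_perm_id: "block_perm b k id = id"
  by (auto simp: block_perm_def)

lemma rho_ext_block_part:
  assumes "sum_list \<mu> = b ! k"
  shows "rho_ext \<zeta> k \<mu> (block_part b k (x, w)) =
    (\<zeta> powi sum x (block b k)) ^ k \<cdot>\<^sub>m rho_S \<mu> (block_perm b k w)"
proof -
  have *: "(\<Sum>i\<in>{1..b ! k}. (\<lambda>i\<in>{1..b ! k}. x (block_off b k + i)) i) = sum x (block b k)"
    by (rule sum.reindex_bij_witness[of _ "\<lambda>i. i - block_off b k" "\<lambda>i. block_off b k + i"])
      (auto simp: block_def)
  show ?thesis
    by (simp only: rho_ext_def block_part_def zeta_char_def prod.case snd_conv assms block_perm_def *)
qed

lemma prod_list_upt: "prod_list (map h [0..<m]) = (\<Prod>k<m. h k)" for h :: "nat \<Rightarrow> 'a :: comm_monoid_mult"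
  by (simp add: prod.distinct_set_conv_list atLeast0LessThan[symmetric] flip: set_upt)

section \<open>The representation of the block subgroup that is induced\<close>

locale wreath_rep =
  fixes L :: "nat list list" and \<zeta> :: complex
  assumes r_pos: "length L > 0" and root: "\<zeta> ^ length L = 1"
begin

abbreviation b where "b \<equiv> map sum_list L"
abbreviation r where "r \<equiv> length L"
abbreviation n where "n \<equiv> sum_list b"
definition d where "d = (\<Prod>k<r. f_dim (L ! k))"

lemma block_tensor_eq: "block_tensor \<zeta> L (x, w) = foldr kron
    (map (\<lambda>k. (\<zeta> powi sum x (block b k)) ^ k \<cdot>\<^sub>m rho_S (L ! k) (block_perm b k w)) [0..<r]) (1\<^sub>m 1)"
  unfolding block_tensor_def
  by (intro arg_cong[of _ _ "\<lambda>l. foldr kron l (1\<^sub>m 1)"] map_cong refl rho_ext_block_part) auto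

lemma summand_carrier: "c \<cdot>\<^sub>m rho_S \<mu> w \<in> carrier_mat (f_dim \<mu>) (f_dim \<mu>)"
  using rho_S_carrier by simp

lemma block_tensor_carrier: "block_tensor \<zeta> L (x, w) \<in> carrier_mat d d"
  unfolding block_tensor_eq d_def prod_list_upt[symmetric]
  by (rule foldr_kron_carrier) (rule summand_carrier)

lemma block_tensor_one: "block_tensor \<zeta> L (\<lambda>i\<in>{1..n}. 0, id) = 1\<^sub>m d"
proof -
  have "sum (\<lambda>i\<in>{1..n}. 0 :: int) (block b k) = 0" if "k < r" for k
    using block_subset[of k b] that by (intro sum.neutral) auto
  then have "block_tensor \<zeta> L (\<lambda>i\<in>{1..n}. 0, id) =
      foldr kron (map (\<lambda>k. 1\<^sub>m (f_dim (L ! k))) [0..<r]) (1\<^sub>m 1)"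
    unfolding block_tensor_eq
    by (intro arg_cong[of _ _ "\<lambda>l. foldr kron l (1\<^sub>m 1)"] map_cong refl)
      (auto simp: block_perm_id rho_S_id)
  then show ?thesis
    by (simp only: foldr_kron_one d_def prod_list_upt)
qed

text \<open>Each tensor factor is multiplicative: its scalar because the block sums add modulo r and
  \<zeta>^r = 1, its matrix because restricting block-stable permutations to a block respects
  composition. The mixed-product rule assembles the factors.\<close>

lemma block_tensor_mult:
  assumes "(x, w) \<in> block_subgroup b r" "(y, v) \<in> block_subgroup b r"
  shows "block_tensor \<zeta> L ((x, w) \<otimes>\<^bsub>Gnr n r\<^esub> (y, v)) = block_tensor \<zeta> L (x, w) * block_tensor \<zeta> L (y, v)"
proof -
  have w: "w permutes {1..n}" and v: "v permutes {1..n}"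
    using assms r_pos by (auto simp: mem_block_subgroup carrier_Gnr)
  have wk: "w ` block b k = block b k" and vk: "v ` block b k = block b k" if "k < r" for k
    using assms that by (auto simp: mem_block_subgroup)
  define z where "z = (\<lambda>i\<in>{1..n}. (x i + y (inv' w i)) mod int r)"
  have z: "\<zeta> powi sum z (block b k) = \<zeta> powi sum x (block b k) * \<zeta> powi sum y (block b k)"
    if k: "k < r" for k
  proof -
    have sub: "block b k \<subseteq> {1..n}" using block_subset[of k b] k by simp
    have "sum z (block b k) = (\<Sum>i\<in>block b k. (x i + y (inv' w i)) mod int r)"
      using sub by (intro sum.cong) (auto simp: z_def)
    then have "\<zeta> powi sum z (block b k) = \<zeta> powi (sum x (block b k) + sum y (block b k))"
      by (simp only:) (rule powi_mod_cong[OF root r_pos sum_twisted_mod[OF w sub wk[OF k]]])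
    also have "\<dots> = \<zeta> powi sum x (block b k) * \<zeta> powi sum y (block b k)"
      using root r_pos by (subst power_int_add) (auto simp: power_0_left)
    finally show ?thesis .
  qed
  have "block_tensor \<zeta> L ((x, w) \<otimes>\<^bsub>Gnr n r\<^esub> (y, v)) = block_tensor \<zeta> L (z, w \<circ> v)"
    by (simp add: mult_Gnr[OF w] z_def)
  also have "\<dots> = foldr kron
    (map (\<lambda>k. ((\<zeta> powi sum x (block b k)) ^ k \<cdot>\<^sub>m rho_S (L ! k) (block_perm b k w)) *
              ((\<zeta> powi sum y (block b k)) ^ k \<cdot>\<^sub>m rho_S (L ! k) (block_perm b k v))) [0..<r]) (1\<^sub>m 1)"
    unfolding block_tensor_eq
  proof (intro arg_cong[of _ _ "\<lambda>l. foldr kron l (1\<^sub>m 1)"] map_cong refl)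
    fix k assume "k \<in> set [0..<r]"
    then have k: "k < r" by simp
    have "rho_S (L ! k) (block_perm b k (w \<circ> v)) =
        rho_S (L ! k) (block_perm b k w) * rho_S (L ! k) (block_perm b k v)"
      unfolding block_perm_comp[OF vk[OF k]]
      using block_perm_permutes[OF w wk[OF k]] block_perm_permutes[OF v vk[OF k]] k
      by (intro rho_S_comp) simp_all
    then show "(\<zeta> powi sum z (block b k)) ^ k \<cdot>\<^sub>m rho_S (L ! k) (block_perm b k (w \<circ> v)) =
        (\<zeta> powi sum x (block b k)) ^ k \<cdot>\<^sub>m rho_S (L ! k) (block_perm b k w) *
        ((\<zeta> powi sum y (block b k)) ^ k \<cdot>\<^sub>m rho_S (L ! k) (block_perm b k v))"
      using z[OF k] rho_S_carrier[of "L ! k"]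
      by (simp add: power_mult_distrib smult_mat_mult_smult_mat[of _ "f_dim (L ! k)"])
  qed
  also have "\<dots> = block_tensor \<zeta> L (x, w) * block_tensor \<zeta> L (y, v)"
    unfolding block_tensor_eq
    by (rule foldr_kron_mult[symmetric]) (rule summand_carrier)+
  finally show ?thesis .
qed

lemma mat_trace_block_tensor:
  "mat_trace (block_tensor \<zeta> L (x, w)) =
    (\<Prod>k<r. (\<zeta> powi sum x (block b k)) ^ k * chi_S (L ! k) (block_perm b k w))"
proof -
  have "mat_trace (block_tensor \<zeta> L (x, w)) = prod_list (map (\<lambda>k.
      mat_trace ((\<zeta> powi sum x (block b k)) ^ k \<cdot>\<^sub>m rho_S (L ! k) (block_perm b k w))) [0..<r])"
    unfolding block_tensor_eq by (rule mat_trace_foldr_kron) (rule summand_carrier)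
  then show ?thesis
    by (simp add: prod_list_upt mat_trace_smult[OF rho_S_carrier] chi_S_def)
qed

sublocale finite_induction "Gnr n r" "block_subgroup b r" d "block_tensor \<zeta> L"
proof (intro finite_induction.intro finite_induction_axioms.intro)
  show "group (Gnr n r)" using r_pos by (rule group_Gnr)
  show "finite (carrier (Gnr n r))" using r_pos by (rule finite_carrier_Gnr)
  show "subgroup (block_subgroup b r) (Gnr n r)" using subgroup_block[OF r_pos, of b] by simp
  show "block_tensor \<zeta> L h \<in> carrier_mat d d" for h
    by (cases h) (simp only: block_tensor_carrier)
  show "block_tensor \<zeta> L \<one>\<^bsub>Gnr n r\<^esub> = 1\<^sub>m d"
    by (simp only: one_Gnr block_tensor_one)
  show "block_tensor \<zeta> L (g \<otimes>\<^bsub>Gnr n r\<^esub> h) = block_tensor \<zeta> L g * block_tensor \<zeta> L h"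
    if "g \<in> block_subgroup b r" "h \<in> block_subgroup b r" for g h
    using that by (cases g; cases h) (simp only: block_tensor_mult)
qed

lemma rho_eq: "rho \<zeta> L = induced_mat (Gnr n r) (block_subgroup b r) (block_tensor \<zeta> L)"
  by (simp add: rho_def fun_eq_iff)

end

subsection \<open>The trace at a transposition\<close>

lemma card_permutes_stabilizing:
  fixes m :: nat and B :: "nat \<Rightarrow> 'a set"
  assumes "\<And>k. k < m \<Longrightarrow> finite (B k)" and "\<And>j k. j < m \<Longrightarrow> k < m \<Longrightarrow> j \<noteq> k \<Longrightarrow> B j \<inter> B k = {}"
  shows "card {w. w permutes (\<Union>k<m. B k) \<and> (\<forall>k<m. w ` B k = B k)} = (\<Prod>k<m. fact (card (B k)))"
  using assms
proof (induction m)
  case 0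
  have "{w. w permutes ({} :: 'a set)} = {id}" by auto
  then show ?case by simp
next
  case (Suc m)
  define A where "A = (\<Union>k<m. B k)"
  define P where "P = {w. w permutes A \<and> (\<forall>k<m. w ` B k = B k)}"
  define Q where "Q = {w. w permutes B m}"
  have dis: "A \<inter> B m = {}"
  proof -
    have "B j \<inter> B m = {}" if "j < m" for j
      using Suc.prems(2)[of j m] that by simp
    then show ?thesis by (auto simp: A_def)
  qed
  have sub: "B k \<subseteq> A" if "k < m" for k using that by (auto simp: A_def)
  have Un: "(\<Union>k<Suc m. B k) = A \<union> B m"
    by (auto simp: A_def lessThan_Suc)
  have fixA: "q x = x" if "q \<in> Q" "x \<notin> B m" for q x
    using that by (auto simp: Q_def permutes_def)
  have fixB: "p x = x" if "p \<in> P" "x \<notin> A" for p x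
    using that by (auto simp: P_def permutes_def)
  \<comment> \<open>Split off the last block: elements of \<open>P\<close> and \<open>Q\<close> have
    disjoint supports, so composition identifies pairs with stabilizing permutations, and the
    induction multiplies the factorials.\<close>
  have "bij_betw (\<lambda>(p, q). p \<circ> q) (P \<times> Q)
      {w. w permutes (A \<union> B m) \<and> (\<forall>k<Suc m. w ` B k = B k)}" (is "bij_betw _ _ ?W")
  proof (rule bij_betw_imageI)
    show "inj_on (\<lambda>(p, q). p \<circ> q) (P \<times> Q)"
    proof (rule inj_onI, clarify)
      fix p q p' q' assume *: "p \<in> P" "q \<in> Q" "p' \<in> P" "q' \<in> Q" "p \<circ> q = p' \<circ> q'"
      have "p x = p' x" for x
      proof (cases "x \<in> A")
        case True
        then have "x \<notin> B m" using dis by auto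
        then show ?thesis using fixA[OF *(2), of x] fixA[OF *(4), of x] fun_cong[OF *(5), of x] by simp
      qed (use fixB[OF *(1)] fixB[OF *(3)] in simp)
      then have "p = p'" by auto
      moreover have "inj p" using * permutes_inj by (auto simp: P_def)
      ultimately have "q x = q' x" for x
        using fun_cong[OF *(5), of x] by (simp add: inj_eq)
      then show "p = p' \<and> q = q'"
        using \<open>p = p'\<close> by auto
    qed
    show "(\<lambda>(p, q). p \<circ> q) ` (P \<times> Q) = ?W"
    proof (intro equalityI subsetI)
      fix w assume "w \<in> (\<lambda>(p, q). p \<circ> q) ` (P \<times> Q)"
      then obtain p q where pq: "p \<in> P" "q \<in> Q" "w = p \<circ> q" by auto
      have "p permutes (A \<union> B m)" "q permutes (A \<union> B m)"
        using pq by (auto simp: P_def Q_def intro: permutes_subset)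
      then have "w permutes (A \<union> B m)"
        using pq by (simp add: permutes_compose)
      moreover have "w ` B k = B k" if "k < Suc m" for k
      proof (cases "k = m")
        case True
        have "p ` B m = id ` B m" using fixB[OF pq(1)] dis by (intro image_cong) auto
        moreover have "q ` B m = B m" using pq by (simp add: Q_def permutes_image)
        ultimately show ?thesis
          unfolding pq(3) True image_comp[symmetric] by (simp only: image_id id_apply)
      next
        case False
        then have k: "k < m" using that by simp
        have "q ` B k = id ` B k" using fixA[OF pq(2)] dis sub[OF k] by (intro image_cong) auto
        moreover have "p ` B k = B k" using pq k by (simp add: P_def)
        ultimately show ?thesis
          unfolding pq(3) image_comp[symmetric] by (simp only: image_id id_apply)
      qed
      ultimately show "w \<in> ?W" by auto
    next
      fix w assume w: "w \<in> ?W"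
      then have wp: "w permutes (A \<union> B m)" and wk: "\<And>k. k < Suc m \<Longrightarrow> w ` B k = B k" by auto
      \<comment> \<open>Restrict w to the earlier blocks and to the last one, and extend by the
        identity; stability of the blocks makes both restrictions bijective.\<close>
      define p q where "p x = (if x \<in> A then w x else x)" and "q x = (if x \<in> B m then w x else x)" for x
      have wA: "w ` A = A" using wk by (auto simp: A_def image_UN)
      have restr: "(\<lambda>x. if x \<in> C then w x else x) permutes C" if "w ` C = C" for C
      proof (rule bij_imp_permutes)
        have "bij_betw w C C"
          using that inj_on_subset[OF permutes_inj[OF wp] subset_UNIV] by (simp add: bij_betw_def)
        then show "bij_betw (\<lambda>x. if x \<in> C then w x else x) C C"
          by (subst bij_betw_cong[of _ _ w]) auto
      qed auto
      have "p permutes A" "q permutes B m"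
        using restr[OF wA] restr[OF wk[of m]] by (simp_all add: p_def[abs_def] q_def[abs_def])
      moreover have "p ` B k = B k" if "k < m" for k
      proof -
        have "p ` B k = w ` B k" using sub[OF that] by (intro image_cong) (auto simp: p_def)
        then show ?thesis using wk[of k] that by simp
      qed
      ultimately have "p \<in> P" "q \<in> Q" by (auto simp: P_def Q_def)
      moreover have "w = p \<circ> q"
      proof
        fix x
        have "w x \<in> B m" if "x \<in> B m" using wk[of m] that by auto
        moreover have "w x = x" if "x \<notin> A" "x \<notin> B m"
          using wp that by (simp add: permutes_def)
        ultimately show "w x = (p \<circ> q) x"
          using dis by (auto simp: p_def q_def)
      qed
      ultimately show "w \<in> (\<lambda>(p, q). p \<circ> q) ` (P \<times> Q)" by auto
    qed
  qed
  then have "card ?W = card P * card Q"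
    by (simp add: bij_betw_same_card[symmetric] card_cartesian_product)
  moreover have "card P = (\<Prod>k<m. fact (card (B k)))"
    unfolding P_def A_def using Suc.prems by (intro Suc.IH) auto
  moreover have "card Q = fact (card (B m))"
    unfolding Q_def using Suc.prems(1)[of m] by (intro card_permutations) auto
  ultimately show ?case by (simp add: Un mult.commute)
qed

text \<open>Composing with a fixed \<open>u\<close> that sends a to p and c to q turns the two
  conditions into two fixed points, leaving the permutations of the other points.\<close>

lemma card_permutes_two_points:
  assumes "finite S" "p \<in> S" "q \<in> S" "a \<in> S" "c \<in> S" "p \<noteq> q" "a \<noteq> c"
  shows "card {w. w permutes S \<and> w p = a \<and> w q = c} = fact (card S - 2)"
proof -
  obtain u where u: "u permutes S" "u a = p" "u c = q"
    using permutes_two_points[of a S c p q] assms by auto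
  have "bij_betw (\<lambda>w. u \<circ> w) {w. w permutes S \<and> w p = a \<and> w q = c} {w. w permutes (S - {p, q})}"
  proof (rule bij_betw_byWitness[of _ "\<lambda>w. inv' u \<circ> w"])
    show "(\<lambda>w. u \<circ> w) ` {w. w permutes S \<and> w p = a \<and> w q = c} \<subseteq> {w. w permutes (S - {p, q})}"
    proof clarify
      fix w assume "w permutes S" "a = w p" "c = w q"
      then show "u \<circ> w permutes (S - {p, q})"
        using u by (intro permutes_superset[OF permutes_compose]) auto
    qed
    show "(\<lambda>w. inv' u \<circ> w) ` {w. w permutes (S - {p, q})} \<subseteq> {w. w permutes S \<and> w p = a \<and> w q = c}"
    proof clarify
      fix w assume w: "w permutes (S - {p, q})"
      then have "w p = p" "w q = q" by (auto simp: permutes_def)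
      moreover have "w permutes S" using w by (rule permutes_subset) auto
      ultimately show "inv' u \<circ> w permutes S \<and> (inv' u \<circ> w) p = a \<and> (inv' u \<circ> w) q = c"
        using u permutes_compose permutes_inv[OF u(1)] permutes_inverses(2)[OF u(1)] by (metis comp_apply)
    qed
  qed (auto simp: o_assoc permutes_inv_o[OF u(1)])
  then have "card {w. w permutes S \<and> w p = a \<and> w q = c} = card {w. w permutes (S - {p, q})}"
    by (rule bij_betw_same_card)
  also have "\<dots> = fact (card S - 2)"
    using assms by (intro card_permutations) (auto simp: card_Diff_subset)
  finally show ?thesis .
qed

text \<open>Sort the permutations by the ordered pair of preimages of a and c: there are b(b - 1)
  pairs of distinct points in \<open>B\<close>, and the previous count applies to each.\<close>

lemma card_permutes_two_preimages:
  assumes "finite S" "B \<subseteq> S" "a \<in> S" "c \<in> S" "a \<noteq> c"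
  shows "card {w. w permutes S \<and> inv' w a \<in> B \<and> inv' w c \<in> B} = card B * (card B - 1) * fact (card S - 2)"
proof -
  define D where "D = Sigma B (\<lambda>p. B - {p})"
  have finB: "finite B" using assms finite_subset by blast
  have "{w. w permutes S \<and> inv' w a \<in> B \<and> inv' w c \<in> B} =
      (\<Union>(p, q)\<in>D. {w. w permutes S \<and> w p = a \<and> w q = c})"
  proof (intro equalityI subsetI)
    fix w assume w: "w \<in> {w. w permutes S \<and> inv' w a \<in> B \<and> inv' w c \<in> B}"
    then have "w (inv' w a) = a" "w (inv' w c) = c"
      using permutes_inverses(1)[of w S] by simp_all
    moreover from this have "inv' w a \<noteq> inv' w c"
      using assms(5) by metis
    ultimately show "w \<in> (\<Union>(p, q)\<in>D. {w. w permutes S \<and> w p = a \<and> w q = c})"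
      using w by (intro UN_I[of "(inv' w a, inv' w c)"]) (auto simp: D_def)
  next
    fix w assume "w \<in> (\<Union>(p, q)\<in>D. {w. w permutes S \<and> w p = a \<and> w q = c})"
    then obtain p q where pq: "(p, q) \<in> D" "w permutes S" "w p = a" "w q = c" by blast
    then have "inv' w a = p" "inv' w c = q"
      using permutes_inv_eq[OF pq(2)] by simp_all
    then show "w \<in> {w. w permutes S \<and> inv' w a \<in> B \<and> inv' w c \<in> B}"
      using pq by (simp add: D_def)
  qed
  also have "card \<dots> = (\<Sum>(p, q)\<in>D. card {w. w permutes S \<and> w p = a \<and> w q = c})"
  proof (subst card_UN_disjoint)
    show "finite D" using finB by (auto simp: D_def)
    show "\<forall>i\<in>D. finite (case i of (p, q) \<Rightarrow> {w. w permutes S \<and> w p = a \<and> w q = c})"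
      using finite_permutations[OF assms(1)] by (auto intro: finite_subset)
    show "\<forall>i\<in>D. \<forall>j\<in>D. i \<noteq> j \<longrightarrow> (case i of (p, q) \<Rightarrow> {w. w permutes S \<and> w p = a \<and> w q = c}) \<inter>
        (case j of (p, q) \<Rightarrow> {w. w permutes S \<and> w p = a \<and> w q = c}) = {}"
      by (auto simp: permutes_inv_eq[symmetric])
  qed (simp add: case_prod_unfold)
  also have "\<dots> = (\<Sum>x\<in>D. fact (card S - 2))"
    using assms by (intro sum.cong) (auto simp: D_def intro!: card_permutes_two_points)
  also have "\<dots> = card B * (card B - 1) * fact (card S - 2)"
    using finB by (simp add: D_def card_Diff_singleton)
  finally show ?thesis .
qed

section \<open>The formula for y cleared of denominators\<close>

lemma sum_lessThan_squares:
  fixes f :: "nat \<Rightarrow> nat"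
  shows "2 * (\<Sum>j<m. \<Sum>i<j. f i * f j) + (\<Sum>k<m. f k * (f k - 1)) + (\<Sum>k<m. f k) = (\<Sum>k<m. f k)\<^sup>2"
proof (induction m)
  case (Suc m)
  \<comment> \<open>Truncated subtraction does no harm here: where it occurs, at
    \<open>f m = 0\<close>, the other factor vanishes.\<close>
  have *: "f m * (f m - 1) + f m = (f m)\<^sup>2"
    by (cases "f m") (auto simp: power2_eq_square)
  have "2 * (\<Sum>j<Suc m. \<Sum>i<j. f i * f j) + (\<Sum>k<Suc m. f k * (f k - 1)) + (\<Sum>k<Suc m. f k) =
     (\<Sum>k<m. f k)\<^sup>2 + 2 * ((\<Sum>i<m. f i) * f m) + (f m)\<^sup>2"
    unfolding Suc.IH[symmetric] *[symmetric] by (simp add: sum_distrib_right)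
  also have "\<dots> = (\<Sum>k<Suc m. f k)\<^sup>2"
    by (simp add: power2_sum algebra_simps)
  finally show ?case .
qed simp

text \<open>Multiplying by all b_j! leaves b_k!/(b_k - 2)! = b_k(b_k - 1) times N!. For b_k < 2 both
  sides are 0: the left one by the convention on negative lower entries, the right one because
  b_k(b_k - 1) = 0.\<close>

lemma multinomial_sub_two:
  assumes k: "k < length b"
  shows "(\<Prod>j<length b. fact (b ! j)) * multinomial N ((map int b)[k := int (b ! k) - 2]) =
    fact N * of_nat (b ! k * (b ! k - 1))"
proof (cases "b ! k < 2")
  case True
  have "int (b ! k) - 2 \<in> set ((map int b)[k := int (b ! k) - 2])"
    using k by (intro set_update_memI) simp
  then have "multinomial N ((map int b)[k := int (b ! k) - 2]) = 0"
    using True by (force simp: multinomial_def)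
  moreover have "b ! k = 0 \<or> b ! k = 1" using True by auto
  ultimately show ?thesis by auto
next
  case False
  have "(\<Prod>i<length b. fact (nat ((map int b)[k := int (b ! k) - 2] ! i)) :: complex) =
      fact (b ! k - 2) * (\<Prod>i\<in>{..<length b} - {k}. fact (b ! i))"
  proof -
    have "nat (int (b ! k) - 2) = b ! k - 2" by linarith
    then show ?thesis
      using k by (subst prod.remove[of _ k]) (auto intro!: prod.cong arg_cong2[of _ _ _ _ "(*)"])
  qed
  moreover have "(\<Prod>j<length b. fact (b ! j) :: complex) = fact (b ! k) * (\<Prod>i\<in>{..<length b} - {k}. fact (b ! i))"
    using k by (subst prod.remove[of _ k]) auto
  moreover have "\<not> (\<exists>c\<in>set ((map int b)[k := int (b ! k) - 2]). c < 0)"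
    using set_update_subset_insert[of "map int b" k "int (b ! k) - 2"] False by auto
  moreover have "fact (b ! k) = fact (b ! k - 2) * (of_nat (b ! k * (b ! k - 1)) :: complex)"
  proof -
    obtain m where "b ! k = Suc (Suc m)" using False by (metis add_2_eq_Suc le_add_diff_inverse not_less)
    then show ?thesis by (simp add: algebra_simps)
  qed
  moreover have "(\<Prod>i\<in>{..<length b} - {k}. fact (b ! i) :: complex) \<noteq> 0"
    by simp
  ultimately show ?thesis
    by (simp add: multinomial_def)
qed

definition swap_elem :: "nat \<Rightarrow> gelem" where
  "swap_elem n = (\<lambda>i\<in>{1..n}. 0, Transposition.transpose 1 2)"

text \<open>The sum over i < j is traded for n(n - 1) minus the b_k(b_k - 1). What remains are sums
  and products over single indices k, so the right-hand side can be compared with the trace formula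
  and is visibly invariant under reindexing.\<close>

lemma y_val_symmetric:
  fixes L :: "nat list list"
  defines "b k \<equiv> sum_list (L ! k)" and "r \<equiv> length L" and "n \<equiv> sum_list (map sum_list L)"
  assumes n2: "n \<ge> 2"
  shows "(\<Prod>k<r. fact (b k)) * (2 * y_val L) = fact (n - 2) *
    (of_nat (\<Prod>k<r. f_dim (L ! k)) * (of_nat n * of_nat (n - 1) - of_nat (\<Sum>k<r. b k * (b k - 1))) +
     (\<Sum>k<r. 2 * g_mult (L ! k) * of_nat (f_hat L k) * of_nat (b k * (b k - 1))))"
proof -
  let ?P = "\<Prod>k<r. fact (b k) :: complex"
  let ?d = "of_nat (\<Prod>k<r. f_dim (L ! k)) :: complex"
  let ?M = "\<lambda>k. multinomial (n - 2) ((map int (map sum_list L))[k := int (b k) - 2])"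
  define E where "E = (\<Sum>j<r. \<Sum>i<j. b i * b j)"
  define Q where "Q = (\<Sum>k<r. b k * (b k - 1))"
  have bn: "map sum_list L ! k = b k" if "k < r" for k
    using that by (simp add: b_def r_def)
  have "n = (\<Sum>k<r. b k)"
    using bn by (simp add: n_def sum_list_sum_nth atLeast0LessThan r_def[symmetric])
  \<comment> \<open>The n^2 ordered pairs of points: in different blocks, distinct in one block, and
    equal.\<close>
  then have "2 * E + Q + n = n * n"
    using sum_lessThan_squares[of b r] by (simp add: E_def Q_def power2_eq_square)
  moreover have "n * n = n * (n - 1) + n"
    using n2 by (cases n) auto
  ultimately have "2 * E + Q = n * (n - 1)" by linarith
  then have EQ: "2 * of_nat E = of_nat n * of_nat (n - 1) - (of_nat Q :: complex)"
    by (metis (no_types, lifting) add_diff_cancel_right' of_nat_add of_nat_mult of_nat_numeral)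
  have M: "?P * ?M k = fact (n - 2) * of_nat (b k * (b k - 1))" if "k < r" for k
    using multinomial_sub_two[of k "map sum_list L" "n - 2"] that bn
    by (simp add: r_def b_def)
  have P0: "?P \<noteq> 0" by simp
  have "y_val L = ?d * (fact (n - 2) / (\<Prod>k<r. fact (map sum_list L ! k))) *
      of_nat (\<Sum>j<r. \<Sum>i<j. map sum_list L ! i * map sum_list L ! j) +
      (\<Sum>k<r. g_mult (L ! k) * of_nat (f_hat L k) *
        multinomial (n - 2) ((map int (map sum_list L))[k := int (map sum_list L ! k) - 2]))"
    using n2 by (simp only: y_val_def Let_def r_def n_def if_False not_le) simp
  also have "\<dots> = ?d * (fact (n - 2) / ?P) * of_nat E + (\<Sum>k<r. g_mult (L ! k) * of_nat (f_hat L k) * ?M k)"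
    unfolding E_def by (intro arg_cong2[of _ _ _ _ "(+)"] arg_cong2[of _ _ _ _ "(*)"]
      arg_cong2[of _ _ _ _ "(/)"] arg_cong[of _ _ of_nat] sum.cong prod.cong refl) (auto simp: bn)
  finally have "?P * (2 * y_val L) = ?P * (2 * (?d * (fact (n - 2) / ?P) * of_nat E)) +
      (\<Sum>k<r. 2 * g_mult (L ! k) * of_nat (f_hat L k) * (?P * ?M k))"
    by (simp only: distrib_left sum_distrib_left ac_simps)
  also have "?P * (2 * (?d * (fact (n - 2) / ?P) * of_nat E)) = fact (n - 2) * (?d * (2 * of_nat E))"
    using P0 by (simp add: field_simps)
  also have "(\<Sum>k<r. 2 * g_mult (L ! k) * of_nat (f_hat L k) * (?P * ?M k)) =
      (\<Sum>k<r. fact (n - 2) * (2 * g_mult (L ! k) * of_nat (f_hat L k) * of_nat (b k * (b k - 1))))"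
    by (intro sum.cong refl) (simp only: M lessThan_iff ac_simps)
  finally show ?thesis
    unfolding EQ Q_def by (simp only: sum_distrib_left distrib_left)
qed

section \<open>Dimension and trace by Frobenius' formula\<close>

context wreath_rep
begin

definition chi12 where "chi12 k = chi_S (L ! k) (Transposition.transpose 1 2)"

definition torus where "torus = {1..n} \<rightarrow>\<^sub>E {0..<int r}"

lemma torus_card: "card torus > 0"
  using r_pos by (simp add: torus_def card_PiE)

lemma carrier_eq: "carrier (Gnr n r) = torus \<times> {w. w permutes {1..n}}"
  using carrier_Gnr[OF r_pos, where n = n] by (auto simp: torus_def)

lemma card_block_subgroup: "card (block_subgroup b r) = card torus * (\<Prod>k<r. fact (b ! k))"
proof -
  have "block_subgroup b r = torus \<times> {w. w permutes {1..n} \<and> (\<forall>k<r. w ` block b k = block b k)}"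
  proof (rule Set.set_eqI)
    fix g
    show "g \<in> block_subgroup b r \<longleftrightarrow>
        g \<in> torus \<times> {w. w permutes {1..n} \<and> (\<forall>k<r. w ` block b k = block b k)}"
      by (cases g) (simp add: mem_block_subgroup carrier_eq)
  qed
  moreover have "card {w. w permutes (\<Union>k<r. block b k) \<and> (\<forall>k<r. w ` block b k = block b k)} =
      (\<Prod>k<r. fact (card (block b k)))"
    using block_disjoint[of _ b] by (intro card_permutes_stabilizing) (auto simp: block_def)
  moreover have "(\<Union>k<r. block b k) = {1..n}" using UN_block[of b] by simp
  ultimately show ?thesis by (simp add: card_cartesian_product)
qed

text \<open>Frobenius' formula at the identity, where every conjugate contributes \<open>d\<close>.
  It yields the index of the block subgroup without a separate count of cosets; the factor
  \<open>card torus\<close> cancels.\<close>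

lemma dim_rho: "(\<Prod>k<r. fact (b ! k)) * of_nat (length ts * d) = (fact n * of_nat d :: complex)"
proof -
  interpret G: group "Gnr n r" using group_Gnr[OF r_pos] .
  have one: "\<one>\<^bsub>Gnr n r\<^esub> \<in> block_subgroup b r" using subgroup.one_closed[OF subgrp] .
  have "of_nat (card (block_subgroup b r)) * mat_trace (rho \<zeta> L \<one>\<^bsub>Gnr n r\<^esub>) =
      (\<Sum>t\<in>carrier (Gnr n r). \<chi> (inv\<^bsub>Gnr n r\<^esub> t \<otimes>\<^bsub>Gnr n r\<^esub> \<one>\<^bsub>Gnr n r\<^esub> \<otimes>\<^bsub>Gnr n r\<^esub> t))"
    unfolding rho_eq by (rule mat_trace_induced) simp
  also have "\<dots> = (\<Sum>t\<in>carrier (Gnr n r). of_nat d)"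
    using one by (intro sum.cong) (auto simp: \<chi>_def one_\<sigma>)
  also have "\<dots> = of_nat (card torus) * (fact n * of_nat d)"
    by (simp add: carrier_eq card_cartesian_product card_permutations)
  finally show ?thesis
    using torus_card by (simp add: rho_eq induced_mat_one card_block_subgroup del: of_nat_mult)
      (simp add: mult.assoc)
qed

text \<open>
  The \<open>\<int>\<^sub>r\<^sup>n\<close>-part of the conjugate by \<open>(x;w)\<close> is \<open>w\<^sup>-\<^sup>1 \<cdot> (s \<cdot> x - x)\<close>, whose sum over every block
  stable under \<open>w\<^sup>-\<^sup>1 s w\<close> vanishes modulo \<open>r\<close>; so the twists by powers of \<open>\<zeta>\<close> do not contribute.
\<close>

lemma \<chi>_conj_swap:
  assumes n2: "n \<ge> 2" and t: "(x, w) \<in> carrier (Gnr n r)"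
  shows "\<chi> (inv\<^bsub>Gnr n r\<^esub> (x, w) \<otimes>\<^bsub>Gnr n r\<^esub> (swap_elem n) \<otimes>\<^bsub>Gnr n r\<^esub> (x, w)) =
    (\<Sum>j<r. if inv' w 1 \<in> block b j \<and> inv' w 2 \<in> block b j then of_nat (f_hat L j) * chi12 j else 0)"
proof -
  let ?\<tau> = "Transposition.transpose 1 (2 :: nat)"
  have w: "w permutes {1..n}" using t r_pos carrier_Gnr by simp
  note iw = permutes_inv[OF w]
  define p q where "p = inv' w 1" "q = inv' w 2"
  have pq: "p \<in> {1..n}" "q \<in> {1..n}" "p \<noteq> q"
    unfolding p_q_def using permutes_in_image[OF iw] n2 permutes_inj[OF iw] by (auto dest: injD)
  have wpq: "w p = 1" "w q = 2"
    unfolding p_q_def using permutes_inverses(1)[OF w] by auto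
  \<comment> \<open>This is w^-1 (1 2) w: conjugation replaces 1 and 2 by their preimages under
    w.\<close>
  define v where "v = Transposition.transpose p q"
  have wv: "w (v i) = ?\<tau> (w i)" for i
  proof -
    have "w i = 1 \<longleftrightarrow> i = p" "w i = 2 \<longleftrightarrow> i = q"
      unfolding p_q_def using permutes_inv_eq[OF w] by metis+
    then show ?thesis
      using wpq pq(3) by (cases "i = p"; cases "i = q") (simp_all add: v_def)
  qed
  have v_eq: "inv' w \<circ> ?\<tau> \<circ> w = v"
    by (rule ext) (simp only: o_apply wv[symmetric] permutes_inverses(2)[OF w])
  have \<tau>: "?\<tau> permutes {1..n}" using n2 by (intro permutes_swap_id) auto
  have iwt: "inv' w \<circ> ?\<tau> permutes {1..n}" using \<tau> iw by (rule permutes_compose)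
  have inv_iwt: "inv' (inv' w \<circ> ?\<tau>) i = w (v i)" for i
    using o_inv_distrib[OF permutes_bij[OF iw] permutes_bij[OF \<tau>]] permutes_inv_inv[OF w]
    by (simp add: wv)
  define u where "u = (\<lambda>i\<in>{1..n}. (- x (w i) + x (w (v i))) mod int r)"
  have conj: "inv\<^bsub>Gnr n r\<^esub> (x, w) \<otimes>\<^bsub>Gnr n r\<^esub> (swap_elem n) \<otimes>\<^bsub>Gnr n r\<^esub> (x, w) = (u, v)"
    using permutes_in_image[OF w]
    by (auto simp: inv_Gnr[OF r_pos t] swap_elem_def mult_Gnr[OF iw] mult_Gnr[OF iwt] inv_iwt v_eq u_def
        permutes_inv_inv[OF w] mod_simps fun_eq_iff simp del: One_nat_def)
  have v: "v permutes {1..n}" unfolding v_def using pq by (intro permutes_swap_id)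
  have uc: "(u, v) \<in> carrier (Gnr n r)"
    using r_pos v by (auto simp: carrier_Gnr u_def)
  show ?thesis
  proof (cases "\<exists>j<r. p \<in> block b j \<and> q \<in> block b j")
    \<comment> \<open>With p and q in different blocks, \<open>v\<close> moves p out of its block,
      so the conjugate lies outside the subgroup and \<chi> is 0.\<close>
    case False
    have "(u, v) \<notin> block_subgroup b r"
    proof
      assume "(u, v) \<in> block_subgroup b r"
      then have vk: "v ` block b k = block b k" if "k < r" for k
        using that by (auto simp: mem_block_subgroup)
      have "p \<in> (\<Union>k<r. block b k)" using UN_block[of b] pq(1) by (simp only: length_map)
      then obtain j where j: "j < r" "p \<in> block b j" by blast
      then have "v p \<in> block b j" using vk by blast
      then show False using False j by (auto simp: v_def)
    qed
    moreover have "(\<Sum>j<r. if p \<in> block b j \<and> q \<in> block b j then of_nat (f_hat L j) * chi12 j else 0) = 0"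
      using False by (intro sum.neutral) auto
    ultimately show ?thesis
      unfolding conj by (simp add: \<chi>_def p_q_def)
  next
    case True
    then obtain j where j: "j < r" "p \<in> block b j" "q \<in> block b j" by blast
    have other: "p \<notin> block b k \<and> q \<notin> block b k" if "k < r" "k \<noteq> j" for k
      using block_disjoint[of k b j] that j by auto
    have vk: "v ` block b k = block b k" if "k < r" for k
      using j other[OF that] by (cases "k = j") (auto simp: v_def)
    have uH: "(u, v) \<in> block_subgroup b r"
      using uc vk by (auto simp: mem_block_subgroup)
    have zeta1: "\<zeta> powi sum u (block b k) = 1" if k: "k < r" for k
    proof -
      have sub: "block b k \<subseteq> {1..n}" using block_subset[of k b] k by simp
      have "(\<Sum>i\<in>block b k. x (w (v i))) = (\<Sum>i\<in>v ` block b k. x (w i))"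
        using permutes_inj[OF v] by (subst sum.reindex) (auto intro: inj_on_subset)
      then have "(\<Sum>i\<in>block b k. - x (w i) + x (w (v i))) = 0"
        using vk[OF k] by (simp add: sum_subtractf)
      moreover have "sum u (block b k) = (\<Sum>i\<in>block b k. (- x (w i) + x (w (v i))) mod int r)"
        using sub by (intro sum.cong) (auto simp: u_def)
      ultimately have "sum u (block b k) mod int r = 0 mod int r"
        by (simp add: mod_sum_eq)
      from powi_mod_cong[OF root r_pos this] show ?thesis by simp
    qed
    \<comment> \<open>Only block j sees the transposition, and there the offset is subtracted from
      both points; every other block sees the identity, whose character value is the
      dimension.\<close>
    have bp: "chi_S (L ! k) (block_perm b k v) = (if k = j then chi12 j else of_nat (f_dim (L ! k)))"
      if k: "k < r" for k
    proof (cases "k = j")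
      case True
      let ?o = "block_off b j"
      have "block_perm b j v = Transposition.transpose (p - ?o) (q - ?o)"
        using j by (auto simp: fun_eq_iff block_perm_def v_def Transposition.transpose_def block_def)
      moreover have "chi_S (L ! j) (Transposition.transpose (p - ?o) (q - ?o)) = chi12 j"
        unfolding chi12_def using j pq(3) by (intro chi_S_transpose) (auto simp: block_def)
      ultimately show ?thesis using True by simp
    next
      case False
      have "v (block_off b k + i) = block_off b k + i" if "i \<in> {1..b ! k}" for i
        using other[OF k False] that by (auto simp: v_def Transposition.transpose_def block_def)
      then have "block_perm b k v = id"
        by (auto simp: block_perm_def fun_eq_iff)
      then show ?thesis using False by (simp add: chi_S_id)
    qed
    have "\<chi> (u, v) = (\<Prod>k<r. (\<zeta> powi sum u (block b k)) ^ k * chi_S (L ! k) (block_perm b k v))"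
      by (simp only: \<chi>_def uH if_True mat_trace_block_tensor)
    also have "\<dots> = (\<Prod>k<r. if k = j then chi12 j else of_nat (f_dim (L ! k)))"
      by (intro prod.cong refl) (simp only: lessThan_iff zeta1 bp power_one mult_1)
    also have "\<dots> = chi12 j * (\<Prod>k\<in>{..<r} - {j}. of_nat (f_dim (L ! k)))"
      using j by (subst prod.remove[of _ j]) (auto intro!: prod.cong arg_cong2[of _ _ _ _ "(*)"])
    also have "\<dots> = of_nat (f_hat L j) * chi12 j"
      by (simp add: f_hat_def)
    \<comment> \<open>The single value is rewritten as a sum with at most one nonzero term, so that
      the sums over w and over blocks can later be exchanged and each block treated alone.\<close>
    also have "\<dots> = (\<Sum>k<r. if k = j then of_nat (f_hat L j) * chi12 j else 0)"
      using j by simp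
    also have "\<dots> = (\<Sum>k<r. if p \<in> block b k \<and> q \<in> block b k then of_nat (f_hat L k) * chi12 k else 0)"
      using other j by (intro sum.cong) auto
    finally show ?thesis by (simp add: conj p_q_def)
  qed
qed

lemma swap_elem_carrier: "n \<ge> 2 \<Longrightarrow> (swap_elem n) \<in> carrier (Gnr n r)"
  using r_pos by (auto simp: swap_elem_def carrier_Gnr intro!: permutes_swap_id)

text \<open>The contribution of a conjugate depends only on the block holding both preimages of 1
  and 2. Block j holds them for b_j(b_j - 1)(n - 2)! permutations, and the torus coordinates
  contribute the same factor on both sides.\<close>

lemma trace_rho_swap:
  assumes n2: "n \<ge> 2"
  shows "(\<Prod>k<r. fact (b ! k)) * mat_trace (rho \<zeta> L (swap_elem n)) =
    fact (n - 2) * (\<Sum>j<r. of_nat (b ! j * (b ! j - 1)) * of_nat (f_hat L j) * chi12 j)"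
proof -
  let ?c = "\<lambda>j. of_nat (f_hat L j) * chi12 j"
  have cnt: "(\<Sum>w | w permutes {1..n}. if inv' w 1 \<in> block b j \<and> inv' w 2 \<in> block b j then ?c j else 0) =
      fact (n - 2) * (of_nat (b ! j * (b ! j - 1)) * ?c j)" if "j < r" for j
  proof -
    have "card {w. w permutes {1..n} \<and> inv' w 1 \<in> block b j \<and> inv' w 2 \<in> block b j} =
        b ! j * (b ! j - 1) * fact (n - 2)"
      using card_permutes_two_preimages[of "{1..n}" "block b j" 1 2] block_subset[of j b] that n2 by simp
    moreover have "(\<Sum>w | w permutes {1..n}. if inv' w 1 \<in> block b j \<and> inv' w 2 \<in> block b j then ?c j else 0) =
        (\<Sum>w | w permutes {1..n} \<and> inv' w 1 \<in> block b j \<and> inv' w 2 \<in> block b j. ?c j)"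
      by (subst sum.inter_filter[symmetric]) (auto simp: finite_permutations intro!: sum.cong)
    ultimately show ?thesis by (simp add: algebra_simps del: One_nat_def)
  qed
  have "of_nat (card (block_subgroup b r)) * mat_trace (rho \<zeta> L (swap_elem n)) =
      (\<Sum>t\<in>carrier (Gnr n r). \<chi> (inv\<^bsub>Gnr n r\<^esub> t \<otimes>\<^bsub>Gnr n r\<^esub> (swap_elem n) \<otimes>\<^bsub>Gnr n r\<^esub> t))"
    unfolding rho_eq by (rule mat_trace_induced) (rule swap_elem_carrier[OF n2])
  also have "\<dots> = (\<Sum>(x, w)\<in>torus \<times> {w. w permutes {1..n}}.
      \<Sum>j<r. if inv' w 1 \<in> block b j \<and> inv' w 2 \<in> block b j then ?c j else 0)"
    by (intro sum.cong) (auto simp: carrier_eq \<chi>_conj_swap[OF n2] simp del: One_nat_def)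
  also have "\<dots> = of_nat (card torus) * (\<Sum>w | w permutes {1..n}.
      \<Sum>j<r. if inv' w 1 \<in> block b j \<and> inv' w 2 \<in> block b j then ?c j else 0)"
    by (subst sum.cartesian_product[symmetric]) simp
  also have "\<dots> = of_nat (card torus) * (\<Sum>j<r. fact (n - 2) * (of_nat (b ! j * (b ! j - 1)) * ?c j))"
    by (subst sum.swap) (intro arg_cong2[of _ _ _ _ "(*)"] refl sum.cong cnt, simp)
  finally have "of_nat (card torus) * ((\<Prod>k<r. fact (b ! k)) * mat_trace (rho \<zeta> L (swap_elem n))) =
      of_nat (card torus) * (fact (n - 2) * (\<Sum>j<r. of_nat (b ! j * (b ! j - 1)) * of_nat (f_hat L j) * chi12 j))"
    by (simp only: card_block_subgroup of_nat_mult of_nat_prod of_nat_fact sum_distrib_left mult.assoc)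
  then show ?thesis using torus_card by simp
qed

text \<open>As (1 2) is an involution, its determinant is (-1)^m with 2m equal to dimension minus
  trace. Both are known up to the product of the b_k!, and \<open>y_val_symmetric\<close> matches
  their difference. This is also what shows that y is a natural number.\<close>

lemma y_val_eq_det_exponent:
  assumes n2: "n \<ge> 2"
  obtains m :: nat where "y_val L = of_nat m" "det (rho \<zeta> L (swap_elem n)) = (-1) ^ m"
proof -
  interpret G: group "Gnr n r" using group_Gnr[OF r_pos] .
  let ?P = "\<Prod>k<r. fact (b ! k) :: complex"
  let ?s = "(swap_elem n)"
  have "?s \<otimes>\<^bsub>Gnr n r\<^esub> ?s = \<one>\<^bsub>Gnr n r\<^esub>"
  proof -
    let ?\<tau> = "Transposition.transpose 1 (2 :: nat)"
    have \<tau>: "?\<tau> permutes {1..n}" using n2 by (intro permutes_swap_id) auto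
    have "?\<tau> i \<in> {1..n}" if "i \<in> {1..n}" for i
      using permutes_in_image[OF \<tau>] that by blast
    then show ?thesis
      unfolding swap_elem_def mult_Gnr[OF \<tau>] one_Gnr
      by (auto simp del: atLeastAtMost_iff One_nat_def intro!: restrict_ext)
  qed
  then have "rho \<zeta> L ?s * rho \<zeta> L ?s = 1\<^sub>m (length ts * d)"
    unfolding rho_eq using induced_mat_mult[of ?s ?s] swap_elem_carrier[OF n2] induced_mat_one by simp
  moreover have "rho \<zeta> L ?s \<in> carrier_mat (length ts * d) (length ts * d)"
    unfolding rho_eq by (rule induced_mat_carrier)
  ultimately obtain m :: nat where m: "det (rho \<zeta> L ?s) = (-1) ^ m"
    "mat_trace (rho \<zeta> L ?s) = of_nat (length ts * d) - 2 * of_nat m"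
    using involution_det_trace by blast
  define T where "T = (\<Sum>j<r. of_nat (b ! j * (b ! j - 1)) * of_nat (f_hat L j) * chi12 j)"
  have "?P * (of_nat (length ts * d) - 2 * of_nat m) = fact (n - 2) * T"
    using trace_rho_swap[OF n2] unfolding m T_def .
  then have Pm: "?P * (2 * of_nat m) = fact n * of_nat d - fact (n - 2) * T"
    using dim_rho by (simp add: algebra_simps)
  define Q where "Q k = sum_list (L ! k) * (sum_list (L ! k) - 1)" for k
  have T_eq: "T = (\<Sum>k<r. of_nat (Q k) * of_nat (f_hat L k) * chi12 k)"
    unfolding T_def Q_def by (intro sum.cong) auto
  have P_eq: "?P = (\<Prod>k<r. fact (sum_list (L ! k)))"
    by (intro prod.cong) auto
  have fd: "of_nat (f_dim (L ! k)) * of_nat (f_hat L k) = (of_nat d :: complex)" if "k < r" for k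
    unfolding d_def f_hat_def using that by (subst prod.remove[of _ k]) auto
  have g: "2 * g_mult (L ! k) * of_nat (f_hat L k) * of_nat (Q k) =
      of_nat (Q k) * of_nat d - of_nat (Q k) * of_nat (f_hat L k) * chi12 k" if k: "k < r" for k
  \<comment> \<open>For a component of size below 2, (1 2) is not in its symmetric group and
    \<open>chi12 k\<close> has no meaning as a character value, but the factor \<open>Q k\<close> is
    0.\<close>
  proof (cases "sum_list (L ! k) \<ge> 2")
    case False
    then have "sum_list (L ! k) = 0 \<or> sum_list (L ! k) = 1" by linarith
    then have "Q k = 0" by (auto simp: Q_def)
    then show ?thesis by simp
  next
    case True
    then have "2 * g_mult (L ! k) = of_nat (f_dim (L ! k)) - chi12 k"
      using k by (simp add: g_mult_def chi12_def)
    then show ?thesis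
      by (simp only: fd[OF k, symmetric]) (simp add: algebra_simps)
  qed
  have "?P * (2 * y_val L) = fact (n - 2) * (of_nat d * (of_nat n * of_nat (n - 1) - of_nat (\<Sum>k<r. Q k)) +
     (\<Sum>k<r. 2 * g_mult (L ! k) * of_nat (f_hat L k) * of_nat (Q k)))"
    unfolding P_eq d_def Q_def by (rule y_val_symmetric[OF n2])
  also have "(\<Sum>k<r. 2 * g_mult (L ! k) * of_nat (f_hat L k) * of_nat (Q k)) =
      of_nat (\<Sum>k<r. Q k) * of_nat d - T"
    by (simp add: g T_eq sum_subtractf sum_distrib_right)
  also have "fact (n - 2) * (of_nat d * (of_nat n * of_nat (n - 1) - of_nat (\<Sum>k<r. Q k)) +
      (of_nat (\<Sum>k<r. Q k) * of_nat d - T)) =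
      (fact (n - 2) * (of_nat n * of_nat (n - 1))) * of_nat d - fact (n - 2) * T"
    by (simp add: algebra_simps)
  also have "fact (n - 2) * (of_nat n * of_nat (n - 1)) = (fact n :: complex)"
  proof -
    obtain l where "n = Suc (Suc l)" using n2 by (metis add_2_eq_Suc le_add_diff_inverse)
    then show ?thesis by (simp add: algebra_simps)
  qed
  finally have "?P * (2 * y_val L) = ?P * (2 * of_nat m)"
    unfolding Pm .
  then have "y_val L = of_nat m" by simp
  with m(1) that show thesis by blast
qed

end

subsection \<open>Linear characters of G(n,r)\<close>

text \<open>The r powers are distinct and there are at most r roots of z^r = 1. The exponents run
  from 1 to r to match the summation range of the counting functions.\<close>

lemma primitive_unity_root_powers:
  assumes "primitive_unity_root r \<zeta>" and r_pos: "r > 0"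
  shows "inj_on (\<lambda>s. \<zeta> ^ s) {1..r}" and "(\<lambda>s. \<zeta> ^ s) ` {1..r} = {z. z ^ r = 1}"
proof -
  have z: "\<zeta> ^ r = 1" "\<And>k. 0 < k \<Longrightarrow> k < r \<Longrightarrow> \<zeta> ^ k \<noteq> 1"
    using assms(1) by (auto simp: primitive_unity_root_def)
  have nz: "\<zeta> \<noteq> 0" using z(1) r_pos by (auto simp: power_0_left)
  have *: "\<zeta> ^ s \<noteq> \<zeta> ^ t" if "s < t" "s \<ge> 1" "t \<le> r" for s t
  proof
    assume "\<zeta> ^ s = \<zeta> ^ t"
    moreover have "\<zeta> ^ t = \<zeta> ^ s * \<zeta> ^ (t - s)" using that by (simp flip: power_add)
    ultimately have "\<zeta> ^ (t - s) = 1" using nz by simp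
    then show False using z(2)[of "t - s"] that by auto
  qed
  show inj: "inj_on (\<lambda>s. \<zeta> ^ s) {1..r}"
    by (rule linorder_inj_onI) (use * in auto)
  show "(\<lambda>s. \<zeta> ^ s) ` {1..r} = {z. z ^ r = 1}"
  proof (rule card_seteq)
    show "finite {z :: complex. z ^ r = 1}" using r_pos by (intro finite_roots_unity) simp
    show "(\<lambda>s. \<zeta> ^ s) ` {1..r} \<subseteq> {z. z ^ r = 1}"
    proof clarify
      fix s
      have "(\<zeta> ^ s) ^ r = (\<zeta> ^ r) ^ s" by (simp only: power_mult[symmetric] mult.commute)
      then show "(\<zeta> ^ s) ^ r = 1" using z(1) by simp
    qed
    show "card {z :: complex. z ^ r = 1} \<le> card ((\<lambda>s. \<zeta> ^ s) ` {1..r})"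
      unfolding card_image[OF inj] using card_roots_unity[of r, where 'a = complex] r_pos by simp
  qed
qed

locale linear_character =
  fixes n r :: nat and D :: "gelem \<Rightarrow> complex"
  assumes n_pos: "n \<ge> 1" and r_pos: "r > 0"
    and D_one: "D \<one>\<^bsub>Gnr n r\<^esub> = 1"
    and D_mult: "\<And>g h. g \<in> carrier (Gnr n r) \<Longrightarrow> h \<in> carrier (Gnr n r) \<Longrightarrow>
      D (g \<otimes>\<^bsub>Gnr n r\<^esub> h) = D g * D h"
begin

definition P where "P w = D (\<lambda>i\<in>{1..n}. 0, w)"
definition T where "T x = D (x, id)"
text \<open>The entry is \<open>1 mod int r\<close> so that the vector lies in the carrier for r = 1
  too, where it is zero.\<close>

definition unit :: "nat \<Rightarrow> nat \<Rightarrow> int" where "unit i = (\<lambda>j\<in>{1..n}. if j = i then 1 mod int r else 0)"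
definition c where "c = T (unit 1)"

lemma carrierI: "x \<in> {1..n} \<rightarrow>\<^sub>E {0..<int r} \<Longrightarrow> w permutes {1..n} \<Longrightarrow> (x, w) \<in> carrier (Gnr n r)"
  using carrier_Gnr[OF r_pos] by simp

lemma zero_torus: "(\<lambda>i\<in>{1..n}. 0) \<in> {1..n} \<rightarrow>\<^sub>E {0..<int r}"
  using r_pos by auto

lemma unit_torus: "unit i \<in> {1..n} \<rightarrow>\<^sub>E {0..<int r}"
  using r_pos by (auto simp: unit_def)

lemma P_id: "P id = 1"
  using D_one by (simp add: P_def one_Gnr)

lemma P_comp:
  assumes "w permutes {1..n}" "v permutes {1..n}"
  shows "P (w \<circ> v) = P w * P v"
proof -
  have "(\<lambda>i\<in>{1..n}. ((\<lambda>i\<in>{1..n}. 0) i + (\<lambda>i\<in>{1..n}. 0) (inv' w i)) mod int r) = (\<lambda>i\<in>{1..n}. 0)"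
    using permutes_in_image[OF permutes_inv[OF assms(1)]] by (auto simp del: atLeastAtMost_iff intro!: restrict_ext)
  then show ?thesis
    using D_mult[OF carrierI[OF zero_torus assms(1)] carrierI[OF zero_torus assms(2)]]
    by (simp add: P_def mult_Gnr[OF assms(1)])
qed

lemma P_nonzero:
  assumes "w permutes {1..n}"
  shows "P w \<noteq> 0"
  using P_comp[OF assms permutes_inv[OF assms]] permutes_inv_o(1)[OF assms] P_id by auto

lemma P_transpose:
  assumes "a \<in> {1..n}" "b \<in> {1..n}" "a \<noteq> b"
  shows "P (Transposition.transpose a b) = P (Transposition.transpose 1 2)"
proof -
  obtain w where w: "w permutes {1..n}" "w 1 = a" "w 2 = b"
    using permutes_two_points[of 1 "{1..n}" 2 a b] assms by auto
  have inj: "w x = w y \<longleftrightarrow> x = y" for x y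
    using permutes_inj[OF w(1)] by (metis injD)
  have "Transposition.transpose a b \<circ> w = w \<circ> Transposition.transpose 1 2"
    by (auto simp: fun_eq_iff Transposition.transpose_def w(2,3)[symmetric] inj)
  moreover have "Transposition.transpose a b permutes {1..n}" "Transposition.transpose 1 2 permutes {1..n}"
    using assms by (auto intro!: permutes_swap_id)
  ultimately have "P (Transposition.transpose a b) * P w = P w * P (Transposition.transpose 1 2)"
    using P_comp w(1) by metis
  then show ?thesis using P_nonzero[OF w(1)] by simp
qed

text \<open>The bound on n matters: for n = 1 \<open>swap_elem\<close> is outside the group, where
  nothing is known about \<open>D\<close>.\<close>

definition \<epsilon> :: bool where "\<epsilon> \<longleftrightarrow> n \<ge> 2 \<and> D (swap_elem n) = -1"

lemma P_swap:
  assumes "n \<ge> 2"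
  shows "P (Transposition.transpose 1 2) = (if \<epsilon> then -1 else 1)"
proof -
  have "Transposition.transpose 1 2 permutes {1..n}"
    using assms by (intro permutes_swap_id) auto
  then have "(P (Transposition.transpose 1 2))\<^sup>2 = 1"
    using P_comp P_id by (metis power2_eq_square transpose_comp_involutory)
  then show ?thesis
    using assms by (auto simp: power2_eq_1_iff \<epsilon>_def P_def swap_elem_def)
qed

lemma P_eq:
  assumes "w permutes {1..n}"
  shows "P w = (if \<epsilon> then of_int (sign w) else 1)"
  using assms finite_atLeastAtMost
proof (induction rule: permutes_induct)
  case id
  then show ?case using P_id by (simp add: id_def)
next
  case (swap a b p)
  have t: "Transposition.transpose a b permutes {1..n}"
    using swap by (intro permutes_swap_id)
  \<comment> \<open>Two distinct points in {1..n} force n \<ge> 2, so \<open>P_swap\<close>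
    applies.\<close>
  have *: "P (Transposition.transpose a b \<circ> p) = (if \<epsilon> then -1 else 1) * P p"
    using P_comp[OF t \<open>p permutes {1..n}\<close>] P_transpose[OF swap(1,2,3)] P_swap swap(1,2,3) by simp
  have **: "sign (Transposition.transpose a b \<circ> p) = - sign p"
    using \<open>a \<noteq> b\<close> sign_compose[of "Transposition.transpose a b" p] permutation_permutes t \<open>p permutes {1..n}\<close>
    by (metis finite_atLeastAtMost mult_minus1 sign_swap_id)
  show ?case unfolding * ** using swap by simp
qed

lemma T_add:
  assumes "x \<in> {1..n} \<rightarrow>\<^sub>E {0..<int r}" "y \<in> {1..n} \<rightarrow>\<^sub>E {0..<int r}"
  shows "T (\<lambda>i\<in>{1..n}. (x i + y i) mod int r) = T x * T y"
  using D_mult[OF carrierI[OF assms(1) permutes_id] carrierI[OF assms(2) permutes_id]]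
  by (simp add: T_def mult_Gnr[OF permutes_id])

lemma T_unit:
  assumes i: "i \<in> {1..n}"
  shows "T (unit i) = c"
proof -
  define w where "w = Transposition.transpose 1 i"
  have w: "w permutes {1..n}" unfolding w_def using i n_pos by (intro permutes_swap_id) auto
  have iw: "inv' w = w" unfolding w_def by (rule inv_transpose_eq)
  let ?z = "\<lambda>j\<in>{1..n}. 0 :: int"
  \<comment> \<open>Conjugacy of the unit vectors is stated as a commutation, so that no inverse has
    to be computed; the nonzero value \<open>P w\<close> cancels afterwards.\<close>
  have "(?z, w) \<otimes>\<^bsub>Gnr n r\<^esub> (unit 1, id) = (unit i, id) \<otimes>\<^bsub>Gnr n r\<^esub> (?z, w)"
  proof -
    have "(?z j + unit 1 (w j)) mod int r = (unit i j + ?z j) mod int r" if "j \<in> {1..n}" for j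
      using that i n_pos permutes_in_image[OF w, of j] by (auto simp: unit_def w_def Transposition.transpose_def)
    then have "(\<lambda>j\<in>{1..n}. (?z j + unit 1 (w j)) mod int r) = (\<lambda>j\<in>{1..n}. (unit i j + ?z j) mod int r)"
      by (rule restrict_ext)
    then show ?thesis
      unfolding mult_Gnr[OF w] mult_Gnr[OF permutes_id] iw inv_id id_apply id_comp comp_id by simp
  qed
  moreover have "D ((?z, w) \<otimes>\<^bsub>Gnr n r\<^esub> (unit 1, id)) = P w * c"
    unfolding P_def c_def T_def
    by (rule D_mult[OF carrierI[OF zero_torus w] carrierI[OF unit_torus permutes_id]])
  moreover have "D ((unit i, id) \<otimes>\<^bsub>Gnr n r\<^esub> (?z, w)) = T (unit i) * P w"
    unfolding P_def T_def
    by (rule D_mult[OF carrierI[OF unit_torus permutes_id] carrierI[OF zero_torus w]])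
  ultimately have "P w * c = T (unit i) * P w" by metis
  then show ?thesis using P_nonzero[OF w] by simp
qed

text \<open>Induction on the coordinate sum, removing one unit vector at a positive coordinate. All
  coordinates stay within 0..<r, so putting the vector back involves no reduction modulo r.\<close>

lemma T_eq:
  assumes "x \<in> {1..n} \<rightarrow>\<^sub>E {0..<int r}"
  shows "T x = c ^ nat (sum x {1..n})"
  using assms
proof (induction "nat (sum x {1..n})" arbitrary: x)
  case 0
  have nn: "x i \<ge> 0" if "i \<in> {1..n}" for i using 0(2) that by auto
  then have "sum x {1..n} = 0"
    using 0(1) sum_nonneg[of "{1..n}" x] by auto
  then have "x i = 0" if "i \<in> {1..n}" for i
    using nn that sum_nonneg_eq_0_iff[of "{1..n}" x] by auto
  then have "x = (\<lambda>i\<in>{1..n}. 0)"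
    using 0(2) by (intro extensionalityI[of _ "{1..n}"]) (auto simp: PiE_iff)
  then have "T x = 1" using P_id by (simp add: T_def P_def)
  then show ?case using 0(1) by simp
next
  case (Suc k)
  have "\<exists>i\<in>{1..n}. x i > 0"
  proof (rule ccontr)
    assume "\<not> (\<exists>i\<in>{1..n}. x i > 0)"
    then have "sum x {1..n} \<le> 0" by (intro sum_nonpos) (meson not_less)
    then show False using Suc(2) by simp
  qed
  then obtain i where i: "i \<in> {1..n}" "x i > 0" by blast
  have xi: "x i < int r" "\<And>j. j \<in> {1..n} \<Longrightarrow> 0 \<le> x j \<and> x j < int r" using Suc.prems i by auto
  define x' where "x' = x(i := x i - 1)"
  have x': "x' \<in> {1..n} \<rightarrow>\<^sub>E {0..<int r}"
  proof -
    have "0 \<le> x i - 1" "x i - 1 < int r" using xi(1) i by linarith+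
    then show ?thesis using Suc.prems i(1) by (auto simp: x'_def PiE_iff extensional_def)
  qed
  have "sum x {1..n} = x i + sum x ({1..n} - {i})" "sum x' {1..n} = x' i + sum x' ({1..n} - {i})"
    using i by (auto simp: sum.remove)
  moreover have "sum x' ({1..n} - {i}) = sum x ({1..n} - {i})"
    by (intro sum.cong) (auto simp: x'_def)
  ultimately have s: "sum x {1..n} = sum x' {1..n} + 1"
    by (simp add: x'_def)
  then have k: "k = nat (sum x' {1..n})" using Suc(2) by linarith
  \<comment> \<open>A coordinate strictly between 0 and r rules out r = 1.\<close>
  have "1 mod int r = 1" using xi(1) i by simp
  have "x = (\<lambda>j\<in>{1..n}. (x' j + unit i j) mod int r)"
  proof (rule extensionalityI[of _ "{1..n}"])
    fix j assume "j \<in> {1..n}"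
    moreover from this have "unit i j = (if j = i then 1 else 0)"
      using \<open>1 mod int r = 1\<close> by (simp add: unit_def)
    ultimately show "x j = (\<lambda>j\<in>{1..n}. (x' j + unit i j) mod int r) j"
      using xi(2)[of j] by (auto simp: x'_def)
  qed (use Suc.prems in \<open>auto simp: PiE_iff\<close>)
  then have "T x = T x' * c"
    using T_add[OF x' unit_torus] T_unit[OF i(1)] by metis
  also have "T x' = c ^ k"
    using Suc(1)[OF k x'] k by simp
  finally show ?case using Suc(2) by (metis power_Suc2)
qed

text \<open>Take r - 1 times the first unit vector, where \<open>T\<close> is c^(r - 1); adding the
  unit vector once more gives 0 modulo r.\<close>

lemma c_root: "c ^ r = 1"
proof -
  define x where "x = (\<lambda>j\<in>{1..n}. if j = 1 then int r - 1 else 0)"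
  have x: "x \<in> {1..n} \<rightarrow>\<^sub>E {0..<int r}"
    using r_pos by (auto simp: x_def)
  have "sum x {1..n} = (\<Sum>j\<in>{1..n}. if j = 1 then int r - 1 else 0)"
    by (intro sum.cong) (auto simp: x_def)
  also have "\<dots> = int r - 1" using n_pos by simp
  finally have "T x = c ^ (r - 1)"
    using T_eq[OF x] by (simp add: nat_minus_as_int)
  moreover have "(\<lambda>j\<in>{1..n}. (x j + unit 1 j) mod int r) = (\<lambda>j\<in>{1..n}. 0)"
    by (auto simp: x_def unit_def mod_simps intro!: restrict_ext)
  then have "T x * c = 1"
    using T_add[OF x unit_torus, of 1] P_id by (simp add: c_def T_def P_def)
  ultimately show ?thesis
    using r_pos by (metis One_nat_def Suc_pred power_Suc2)
qed

lemma D_eq: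
  assumes "(x, w) \<in> carrier (Gnr n r)"
  shows "D (x, w) = c ^ nat (sum x {1..n}) * (if \<epsilon> then of_int (sign w) else 1)"
proof -
  have x: "x \<in> {1..n} \<rightarrow>\<^sub>E {0..<int r}" and w: "w permutes {1..n}"
    using assms carrier_Gnr[OF r_pos] by auto
  have "(\<lambda>i\<in>{1..n}. (x i + (\<lambda>i\<in>{1..n}. 0) i) mod int r) = x"
    using x by (intro extensionalityI[of _ "{1..n}"]) (auto simp: PiE_iff)
  then have "(x, w) = (x, id) \<otimes>\<^bsub>Gnr n r\<^esub> (\<lambda>i\<in>{1..n}. 0, w)"
    by (simp add: mult_Gnr[OF permutes_id])
  then have "D (x, w) = T x * P w"
    using D_mult[OF carrierI[OF x permutes_id] carrierI[OF zero_torus w]] by (simp add: T_def P_def)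
  then show ?thesis by (simp only: T_eq[OF x] P_eq[OF w])
qed

lemma zeta_char_eq:
  assumes "(x, w) \<in> carrier (Gnr n r)"
  shows "zeta_char n \<zeta> (x, w) = \<zeta> ^ nat (sum x {1..n})"
proof -
  have "x \<in> {1..n} \<rightarrow>\<^sub>E {0..<int r}"
    using assms carrier_Gnr[OF r_pos] by auto
  then have "sum x {1..n} \<ge> 0" by (intro sum_nonneg) auto
  then show ?thesis by (simp add: zeta_char_def power_int_def)
qed

text \<open>Existence: \<open>c\<close> is an r-th root of unity, hence a power of \<zeta>.
  Uniqueness: at the first unit vector the sign is 1 and the character \<zeta> takes the value
  \<zeta>, whose powers with exponents 1 to r are distinct.\<close>

lemma ex1_exponent:
  assumes "primitive_unity_root r \<zeta>"
  shows "\<exists>!s. s \<in> {1..r} \<and>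
    (\<forall>g\<in>carrier (Gnr n r). D g = zeta_char n \<zeta> g ^ s * (if \<epsilon> then sgn_char g else 1))"
proof -
  obtain s where s: "s \<in> {1..r}" "c = \<zeta> ^ s"
    using primitive_unity_root_powers(2)[OF assms r_pos] c_root by (metis (mono_tags, lifting) imageE mem_Collect_eq)
  have D_s: "D g = zeta_char n \<zeta> g ^ s * (if \<epsilon> then sgn_char g else 1)" if "g \<in> carrier (Gnr n r)" for g
  proof -
    obtain x w where g: "g = (x, w)" by (cases g)
    show ?thesis
      using D_eq[of x w] zeta_char_eq[of x w \<zeta>] that s(2)
      by (simp add: g sgn_char_def power_mult[symmetric] mult.commute)
  qed
  show ?thesis
  proof (rule ex1I[of _ s])
    show "s \<in> {1..r} \<and> (\<forall>g\<in>carrier (Gnr n r). D g = zeta_char n \<zeta> g ^ s * (if \<epsilon> then sgn_char g else 1))"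
      using s D_s by blast
    fix t assume t: "t \<in> {1..r} \<and>
      (\<forall>g\<in>carrier (Gnr n r). D g = zeta_char n \<zeta> g ^ t * (if \<epsilon> then sgn_char g else 1))"
    show "t = s"
    \<comment> \<open>For r = 1 the unit vector is zero and detects nothing, but then 1 is the only
      exponent.\<close>
    proof (cases "r = 1")
      case False
      have u: "(unit 1, id) \<in> carrier (Gnr n r)" by (rule carrierI[OF unit_torus permutes_id])
      have "sum (unit 1) {1..n} = (\<Sum>j\<in>{1..n}. if j = 1 then 1 else 0)"
        using False r_pos by (intro sum.cong) (auto simp: unit_def)
      then have "zeta_char n \<zeta> (unit 1, id) = \<zeta>"
        using n_pos by (simp only: zeta_char_eq[OF u]) simp
      moreover have "sgn_char (unit 1, id) = 1" by (simp add: sgn_char_def)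
      moreover have "D (unit 1, id) = zeta_char n \<zeta> (unit 1, id) ^ t * (if \<epsilon> then sgn_char (unit 1, id) else 1)"
        using t u by blast
      ultimately have "\<zeta> ^ t = \<zeta> ^ s"
        using D_s[OF u] by (simp only: if_cancel mult_1_right)
      then show ?thesis
        using primitive_unity_root_powers(1)[OF assms r_pos] t s(1) by (auto dest: inj_onD)
    qed (use t s in auto)
  qed
qed

end

subsection \<open>Counting\<close>

context wreath_rep
begin

lemma linear_character_det:
  assumes "n \<ge> 1"
  shows "linear_character n r (\<lambda>g. det (rho \<zeta> L g))"
proof
  show "det (rho \<zeta> L \<one>\<^bsub>Gnr n r\<^esub>) = 1"
    by (simp only: rho_eq induced_mat_one det_one)
  show "det (rho \<zeta> L (g \<otimes>\<^bsub>Gnr n r\<^esub> h)) = det (rho \<zeta> L g) * det (rho \<zeta> L h)"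
    if "g \<in> carrier (Gnr n r)" "h \<in> carrier (Gnr n r)" for g h
    unfolding rho_eq induced_mat_mult[OF that]
    by (rule det_mult[OF induced_mat_carrier induced_mat_carrier])
qed (use assms r_pos in auto)

text \<open>Since y is a natural number, exactly one of the two existential statements holds, and
  (-1)^m decides which. For n < 2 the value is 0, hence even.\<close>

lemma y_val_parity:
  shows "(\<exists>m::int. y_val L = of_int m \<and> odd m) \<longleftrightarrow> n \<ge> 2 \<and> det (rho \<zeta> L (swap_elem n)) = -1" (is "?odd \<longleftrightarrow> ?e")
    and "(\<exists>m::int. y_val L = of_int m \<and> even m) \<longleftrightarrow> \<not> (n \<ge> 2 \<and> det (rho \<zeta> L (swap_elem n)) = -1)" (is "?even \<longleftrightarrow> _")
proof -
  obtain m :: nat where m: "y_val L = of_nat m" "n \<ge> 2 \<and> det (rho \<zeta> L (swap_elem n)) = -1 \<longleftrightarrow> odd m"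
  proof (cases "n \<ge> 2")
    case True
    then obtain m :: nat where "y_val L = of_nat m" "det (rho \<zeta> L (swap_elem n)) = (-1) ^ m"
      using y_val_eq_det_exponent by blast
    then show thesis using that[of m] True by (cases "even m") auto
  next
    case False
    then have "y_val L = of_nat 0" by (simp add: y_val_def Let_def)
    then show thesis using that[of 0] False by auto
  qed
  have "y_val L = of_int k \<longleftrightarrow> k = int m" for k
    unfolding m(1) by (metis of_int_eq_iff of_int_of_nat_eq)
  then show "?odd \<longleftrightarrow> ?e" "?even \<longleftrightarrow> \<not> ?e"
    using m(2) by auto
qed

lemma zeta_swap: "zeta_char n \<zeta> (swap_elem n) = 1"
  by (simp add: zeta_char_def swap_elem_def)

lemma sgn_swap: "sgn_char (swap_elem n) = -1"
  by (simp add: sgn_char_def swap_elem_def sign_swap_id)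

end

text \<open>The sets indexed by s partition the elements satisfying \<open>R\<close>. In use,
  \<open>R\<close> is a parity of y and \<open>Q x s\<close> says that the determinant is the s-th
  character of the corresponding kind.\<close>

lemma sum_card_unique_index:
  assumes "finite X" "finite I"
    and "\<And>x s. x \<in> X \<Longrightarrow> s \<in> I \<Longrightarrow> Q x s \<Longrightarrow> R x"
    and "\<And>x. x \<in> X \<Longrightarrow> R x \<Longrightarrow> \<exists>!s. s \<in> I \<and> Q x s"
  shows "(\<Sum>s\<in>I. card {x \<in> X. Q x s}) = card {x \<in> X. R x}"
proof -
  have "{x \<in> X. R x} = (\<Union>s\<in>I. {x \<in> X. Q x s})"
  proof (intro equalityI subsetI)
    fix x assume "x \<in> {x \<in> X. R x}"
    then show "x \<in> (\<Union>s\<in>I. {x \<in> X. Q x s})"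
      using ex1_implies_ex[OF assms(4)[of x]] by auto
  qed (use assms(3) in auto)
  then have "card {x \<in> X. R x} = card (\<Union>s\<in>I. {x \<in> X. Q x s})"
    by simp
  also have "\<dots> = (\<Sum>s\<in>I. card {x \<in> X. Q x s})"
  proof (rule card_UN_disjoint)
    show "\<forall>i\<in>I. \<forall>j\<in>I. i \<noteq> j \<longrightarrow> {x \<in> X. Q x i} \<inter> {x \<in> X. Q x j} = {}"
    proof (intro ballI impI equals0I)
      fix i j x assume "i \<in> I" "j \<in> I" "i \<noteq> j" "x \<in> {x \<in> X. Q x i} \<inter> {x \<in> X. Q x j}"
      then show False using assms(3)[of x i] assms(4)[of x] by auto
    qed
  qed (use assms in auto)
  finally show ?thesis ..
qed

section \<open>Permuting the components of a multipartition\<close>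

lemma finite_Pnr: "finite (Pnr n r)"
proof (rule finite_subset)
  let ?M = "{\<mu>. set \<mu> \<subseteq> {..n} \<and> length \<mu> \<le> n}"
  show "Pnr n r \<subseteq> {L. set L \<subseteq> ?M \<and> length L \<le> r}"
  proof
    fix L assume L: "L \<in> Pnr n r"
    have "\<mu> \<in> ?M" if "\<mu> \<in> set L" for \<mu>
    proof -
      have "sum_list \<mu> \<in> set (map sum_list L)" using that by auto
      then have le: "sum_list \<mu> \<le> n" using L member_le_sum_list by (fastforce simp: Pnr_def)
      \<comment> \<open>Positive parts bound the number of parts by the size, and finiteness of the
        set of candidates rests on this.\<close>
      have "0 \<notin> set \<mu>" using L that by (auto simp: Pnr_def is_partition_def)
      then have "length \<mu> \<le> sum_list \<mu>" by (induction \<mu>) auto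
      then show ?thesis using le member_le_sum_list[of _ \<mu>] by fastforce
    qed
    then show "L \<in> {L. set L \<subseteq> ?M \<and> length L \<le> r}" using L by (auto simp: Pnr_def)
  qed
  show "finite {L. set L \<subseteq> ?M \<and> length L \<le> r}"
    by (intro finite_lists_length_le) auto
qed

lemma permute_list_Pnr:
  assumes "\<pi> permutes {..<r}" "L \<in> Pnr n r"
  shows "permute_list \<pi> L \<in> Pnr n r"
proof -
  have l: "length L = r" using assms(2) by (simp add: Pnr_def)
  have "sum_list (map sum_list (permute_list \<pi> L)) = sum_list (map sum_list L)"
    using assms(1) l by (metis mset_map mset_permute_list sum_mset_sum_list)
  then show ?thesis
    using assms l by (simp add: Pnr_def)
qed

text \<open>The defining formula is not visibly symmetric because of its sum over i < j. In the form
  of \<open>y_val_symmetric\<close> every ingredient is merely reindexed by \<pi>, and the nonzero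
  factor 2 times the product of factorials cancels.\<close>

lemma y_val_permute_list:
  assumes pi: "\<pi> permutes {..<length L}"
  shows "y_val (permute_list \<pi> L) = y_val L"
proof -
  let ?r = "length L"
  define L' where "L' = permute_list \<pi> L"
  have len: "length L' = ?r" by (simp add: L'_def)
  have nth: "L' ! k = L ! \<pi> k" if "k < ?r" for k
    using permute_list_nth[OF pi that] by (simp add: L'_def)
  have n: "sum_list (map sum_list L') = sum_list (map sum_list L)"
    unfolding L'_def using pi by (metis mset_map mset_permute_list sum_mset_sum_list)
  have P: "(\<Prod>k<?r. F (L' ! k)) = (\<Prod>k<?r. F (L ! k))" for F :: "nat list \<Rightarrow> 'a :: comm_monoid_mult"
    by (subst prod.permute[OF pi]) (simp add: nth)
  have S: "(\<Sum>k<?r. F (L' ! k)) = (\<Sum>k<?r. F (L ! k))" for F :: "nat list \<Rightarrow> 'a :: comm_monoid_add"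
    by (subst sum.permute[OF pi]) (simp add: nth)
  have fh: "f_hat L' k = f_hat L (\<pi> k)" if "k < ?r" for k
  proof -
    have "\<pi> ` ({..<?r} - {k}) = {..<?r} - {\<pi> k}"
      using permutes_image[OF pi] permutes_inj[OF pi] by (simp add: image_set_diff)
    moreover have "inj_on \<pi> ({..<?r} - {k})"
      using permutes_inj[OF pi] inj_on_subset by blast
    ultimately have "f_hat L (\<pi> k) = (\<Prod>j\<in>{..<?r} - {k}. f_dim (L ! \<pi> j))"
      unfolding f_hat_def by (metis (no_types, lifting) comp_apply prod.cong prod.reindex)
    then show ?thesis
      by (simp add: f_hat_def len nth)
  qed
  show ?thesis
  proof (cases "sum_list (map sum_list L) \<ge> 2")
    case False
    then show ?thesis using n by (simp add: y_val_def Let_def L'_def)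
  next
    case True
    have "(\<Sum>k<?r. 2 * g_mult (L' ! k) * of_nat (f_hat L' k) * of_nat (sum_list (L' ! k) * (sum_list (L' ! k) - 1))) =
      (\<Sum>k<?r. 2 * g_mult (L ! k) * of_nat (f_hat L k) * of_nat (sum_list (L ! k) * (sum_list (L ! k) - 1)))"
      by (subst (2) sum.permute[OF pi]) (simp add: nth fh)
    then have "(\<Prod>k<?r. fact (sum_list (L ! k))) * (2 * y_val L') = (\<Prod>k<?r. fact (sum_list (L ! k))) * (2 * y_val L)"
      using y_val_symmetric[OF True] y_val_symmetric[of L'] True
      by (simp only: n len P[of "\<lambda>\<mu>. fact (sum_list \<mu>)"] P[of f_dim] S[of "\<lambda>\<mu>. sum_list \<mu> * (sum_list \<mu> - 1)"])
    then show ?thesis by (simp add: L'_def)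
  qed
qed

text \<open>A permutation taking b to c maps the fibre over b injectively into the fibre over c.
  Exchanging b and c gives the reverse inequality, so all \<open>w_count a\<close> fibres have the
  size of the one over \<open>a\<close>.\<close>

lemma card_rearrangements:
  assumes R: "\<And>\<pi> L. \<pi> permutes {..<r} \<Longrightarrow> L \<in> Pnr n r \<Longrightarrow> R L \<Longrightarrow> R (permute_list \<pi> L)"
    and a: "length a = r"
  shows "card {L \<in> Pnr n r. mset (map sum_list L) = mset a \<and> R L} =
    w_count a * card {L \<in> Pnr n r. map sum_list L = a \<and> R L}"
proof -
  define A where "A b = {L \<in> Pnr n r. map sum_list L = b \<and> R L}" for b
  have fin: "finite (A b)" for b
    using finite_Pnr by (auto simp: A_def)
  have le: "card (A b) \<le> card (A c)" if bc: "mset c = mset b" "length b = r" for b c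
  proof -
    obtain \<pi> where pi: "\<pi> permutes {..<r}" "permute_list \<pi> b = c"
      using mset_eq_permutation[OF bc(1)] bc(2) by metis
    have "inj_on (permute_list \<pi>) (A b)"
    proof (rule inj_onI)
      fix L M assume LM: "L \<in> A b" "M \<in> A b" "permute_list \<pi> L = permute_list \<pi> M"
      have "permute_list (inv' \<pi>) (permute_list \<pi> N) = N" if "N \<in> A b" for N
      proof -
        have "length N = r" using that by (simp add: A_def Pnr_def)
        then show ?thesis
          using permute_list_compose[of "inv' \<pi>" N \<pi>] permutes_inv[OF pi(1)] permutes_inv_o(1)[OF pi(1)] by simp
      qed
      then show "L = M" using LM by metis
    qed
    moreover have "permute_list \<pi> ` A b \<subseteq> A c"
    proof clarify
      fix L assume "L \<in> A b"
      then have L: "L \<in> Pnr n r" "map sum_list L = b" "R L" "length L = r" by (auto simp: A_def Pnr_def)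
      have "map sum_list (permute_list \<pi> L) = c"
        using permute_list_map[of \<pi> L sum_list] pi L by simp
      then show "permute_list \<pi> L \<in> A c"
        using permute_list_Pnr[OF pi(1) L(1)] R[OF pi(1) L(1,3)] by (simp add: A_def)
    qed
    ultimately show ?thesis using card_inj_on_le fin by blast
  qed
  have eq: "card (A b) = card (A a)" if "mset b = mset a" for b
    using le[of b a] le[of a b] that a by (metis le_antisym size_mset)
  have "{L \<in> Pnr n r. mset (map sum_list L) = mset a \<and> R L} = (\<Union>b\<in>permutations_of_multiset (mset a). A b)"
    by (auto simp: A_def permutations_of_multiset_def)
  also have "card \<dots> = (\<Sum>b\<in>permutations_of_multiset (mset a). card (A b))"
    by (intro card_UN_disjoint) (auto simp: A_def finite_Pnr)
  also have "\<dots> = (\<Sum>b\<in>permutations_of_multiset (mset a). card (A a))"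
    by (intro sum.cong eq) (auto simp: permutations_of_multiset_def)
  finally show ?thesis by (simp add: w_count_def A_def)
qed

theorem corollary2:
  fixes n r :: nat and a :: "nat list" and \<zeta> :: complex
  assumes "n \<ge> 1" and "r \<ge> 1"
    and "primitive_unity_root r \<zeta>"
    and "length a = r" and "sorted_wrt (\<ge>) a" and "sum_list a = n"
  shows "(\<Sum>s=1..r. N_minus \<zeta> a s) = w_count a * A1 a \<and>
         (\<Sum>s=1..r. N_plus \<zeta> a s) = w_count a * A0 a"
proof -
  define X where "X = {L \<in> Pnr n r. mset (map sum_list L) = mset a}"
  define odd_y where "odd_y L \<longleftrightarrow> (\<exists>m::int. y_val L = of_int m \<and> odd m)" for L
  define even_y where "even_y L \<longleftrightarrow> (\<exists>m::int. y_val L = of_int m \<and> even m)" for L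
  define Qm where "Qm L s \<longleftrightarrow> (\<forall>g\<in>carrier (Gnr n r). det (rho \<zeta> L g) = zeta_char n \<zeta> g ^ s * sgn_char g)" for L s
  define Qp where "Qp L s \<longleftrightarrow> (\<forall>g\<in>carrier (Gnr n r). det (rho \<zeta> L g) = zeta_char n \<zeta> g ^ s)" for L s
  have finX: "finite X" using finite_Pnr by (simp add: X_def)
  \<comment> \<open>The guard n \<ge> 2 on \<open>Qm\<close> is essential: for n = 1 the sign is
    trivial and \<open>Qm\<close> agrees with \<open>Qp\<close>.\<close>
  have main: "(n \<ge> 2 \<longrightarrow> Qm L s \<longrightarrow> odd_y L) \<and> (Qp L s \<longrightarrow> even_y L) \<and> (odd_y L \<longrightarrow> n \<ge> 2) \<and>
      (odd_y L \<longrightarrow> (\<exists>!s. s \<in> {1..r} \<and> Qm L s)) \<and> (even_y L \<longrightarrow> (\<exists>!s. s \<in> {1..r} \<and> Qp L s))"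
    if "L \<in> X" for L s
  proof -
    have L: "length L = r" "sum_list (map sum_list L) = n"
      using that by (auto simp: X_def Pnr_def)
    interpret W: wreath_rep L \<zeta>
      using assms L by unfold_locales (auto simp: primitive_unity_root_def)
    interpret C: linear_character n r "\<lambda>g. det (rho \<zeta> L g)"
      using W.linear_character_det assms(1) unfolding L by blast
    have o: "odd_y L \<longleftrightarrow> C.\<epsilon>" and e: "even_y L \<longleftrightarrow> \<not> C.\<epsilon>"
      using W.y_val_parity unfolding L C.\<epsilon>_def odd_y_def even_y_def by blast+
    note u = C.ex1_exponent[OF assms(3)]
    have sc: "swap_elem n \<in> carrier (Gnr n r)" if "n \<ge> 2"
      using W.swap_elem_carrier that unfolding L by blast
    have zs: "zeta_char n \<zeta> (swap_elem n) = 1" "sgn_char (swap_elem n) = -1"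
      using W.zeta_swap W.sgn_swap unfolding L by blast+
    \<comment> \<open>Evaluation at (1 2) separates the two kinds of characters, since every power
      of \<zeta> is 1 there and the sign is -1.\<close>
    have "C.\<epsilon>" if "n \<ge> 2" "Qm L s"
      using that sc zs by (auto simp: Qm_def C.\<epsilon>_def)
    moreover have "\<not> C.\<epsilon>" if "Qp L s"
      using that sc zs by (auto simp: Qp_def C.\<epsilon>_def)
    moreover have "n \<ge> 2" if "C.\<epsilon>" using that by (simp add: C.\<epsilon>_def)
    moreover have "\<exists>!s. s \<in> {1..r} \<and> Qm L s" if "C.\<epsilon>"
      using u that by (simp add: Qm_def)
    moreover have "\<exists>!s. s \<in> {1..r} \<and> Qp L s" if "\<not> C.\<epsilon>"
      using u that by (simp add: Qp_def)
    ultimately show ?thesis unfolding o e by blast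
  qed
  have A1: "card {L \<in> X. odd_y L} = w_count a * A1 a"
    using card_rearrangements[of r n odd_y a] assms y_val_permute_list
    by (simp add: X_def A1_def odd_y_def Pnr_def conj_assoc)
  have A0: "card {L \<in> X. even_y L} = w_count a * A0 a"
    using card_rearrangements[of r n even_y a] assms y_val_permute_list
    by (simp add: X_def A0_def even_y_def Pnr_def conj_assoc)
  have "(\<Sum>s=1..r. N_plus \<zeta> a s) = (\<Sum>s=1..r. card {L \<in> X. Qp L s})"
    using assms by (intro sum.cong) (simp_all add: N_plus_def X_def Qp_def conj_assoc)
  also have "\<dots> = card {L \<in> X. even_y L}"
    using main by (intro sum_card_unique_index finX) auto
  finally have plus: "(\<Sum>s=1..r. N_plus \<zeta> a s) = w_count a * A0 a"
    using A0 by simp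
  have "(\<Sum>s=1..r. N_minus \<zeta> a s) = card {L \<in> X. odd_y L}"
  proof (cases "n = 1")
    case True
    \<comment> \<open>An odd y requires n \<ge> 2, so the right-hand side vanishes together with the
      conventional value of \<open>N_minus\<close>.\<close>
    then have "{L \<in> X. odd_y L} = {}" using main by auto
    then have "card {L \<in> X. odd_y L} = 0" by (simp only: card.empty)
    then show ?thesis using True assms by (simp add: N_minus_def)
  next
    case False
    then have "(\<Sum>s=1..r. N_minus \<zeta> a s) = (\<Sum>s=1..r. card {L \<in> X. Qm L s})"
      using assms by (intro sum.cong) (simp_all add: N_minus_def X_def Qm_def conj_assoc)
    also have "\<dots> = card {L \<in> X. odd_y L}"
      using main False assms(1) by (intro sum_card_unique_index finX) auto
    finally show ?thesis .
  qed
  with A1 plus show ?thesis by simp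
qed

end
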